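(* Let $\pi$ be a set partition with $\mathrm{pm}(\pi)\geq 1$. Then there exists a constant $c_2(\pi)$ such that for all positive integers $n$, \[B_n(\pi)\leq c_2(\pi)^n\, n^{n\left(1-\frac{1}{\mathrm{pm}(\pi)}\right)}.\] If $\mathrm{pm}(\pi)=0$, then there exists a constant $c_2(\pi)$ such that $B_n(\pi)\leq c_2(\pi)^n$ for all $n$.
   Context: A set partition of $[N]$ is a partition of $[N]$ into nonempty unordered blocks. A set partition $\pi$ of $[N]$ contains a set partition $\pi'$ of $[M]$ if there is $S\subseteq[N]$, $|S|=M$, such that the restriction of $\pi$ to $S$, transported to $[M]$ via the order-preserving bijection $S\to[M]$, equals $\pi'$; otherwise $\pi$ avoids $\pi'$. $B_n(\pi)$ denotes the number of set partitions of $[n]$ avoiding $\pi$. For permutations $\sigma_1,\ldots,\sigma_d$ of $[m]$, $[\sigma_1,\ldots,\sigma_d]$ is the set partition of $[(d+1)m]$ with blocks $T_i=\{i,m+\sigma_1(i),2m+\sigma_2(i),\ldots,dm+\sigma_d(i)\}$, $i\in[m]$ (for $d=0$ this is the partition of $[m]$ into singletons). The permutability $\mathrm{pm}(\pi)$ of a set partition $\pi$ is the minimum $d\ge 0$ such that there exist $m$ and permutations $\sigma_1,\ldots,\sigma_d\in S_m$ with $[\sigma_1,\ldots,\sigma_d]$ containing $\pi$. *)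

theory Defs
  imports Complex_Main "HOL-Library.Disjoint_Sets" "HOL-Combinatorics.Permutations"
begin

text \<open>A set partition of \<open>[N]\<close> is a \<open>\<pi>\<close> with \<^term>\<open>partition_on {1..N} \<pi>\<close>.\<close>

definition restrict_partition :: "nat set \<Rightarrow> nat set set \<Rightarrow> nat set set" where
  "restrict_partition S \<pi> = (\<inter>) S ` \<pi> - {{}}"

text \<open>The ground sets are recovered as \<open>\<Union>\<pi>\<close> and \<open>\<Union>\<pi>'\<close>. The map \<open>f\<close> is the order-preserving
  bijection from \<open>S\<close> onto \<open>\<Union>\<pi>'\<close>, so it is unique on \<open>S\<close> and forces \<open>S\<close> to have as
  many elements as \<open>\<Union>\<pi>'\<close>.\<close>

definition contains_partition :: "nat set set \<Rightarrow> nat set set \<Rightarrow> bool" where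
  "contains_partition \<pi> \<pi>' \<longleftrightarrow>
     (\<exists>S f. S \<subseteq> \<Union>\<pi> \<and> bij_betw f S (\<Union>\<pi>') \<and> strict_mono_on S f \<and>
        (`) f ` restrict_partition S \<pi> = \<pi>')"

definition avoid_count :: "nat \<Rightarrow> nat set set \<Rightarrow> nat" where
  "avoid_count n \<pi> = card {\<rho>. partition_on {1..n} \<rho> \<and> \<not> contains_partition \<rho> \<pi>}"

text \<open>\<open>[\<sigma>\<^sub>1, \<dots>, \<sigma>\<^sub>d]\<close> for permutations of \<open>[m]\<close>; only \<open>\<sigma> 1, \<dots>, \<sigma> d\<close> are used.\<close>

definition perm_partition :: "nat \<Rightarrow> nat \<Rightarrow> (nat \<Rightarrow> nat \<Rightarrow> nat) \<Rightarrow> nat set set" where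
  "perm_partition m d \<sigma> = (\<lambda>i. insert i {j * m + \<sigma> j i | j. j \<in> {1..d}}) ` {1..m}"

definition permutability :: "nat set set \<Rightarrow> nat" where
  "permutability \<pi> = (LEAST d. \<exists>m \<sigma>. (\<forall>j\<in>{1..d}. \<sigma> j permutes {1..m}) \<and>
     contains_partition (perm_partition m d \<sigma>) \<pi>)"

text \<open>The minimum is over a nonempty set: a partition of \<open>[N]\<close> with \<open>m\<close> blocks is contained in
  \<open>[id, \<dots>, id]\<close> with \<open>N\<close> copies of the identity of \<open>[m]\<close>.\<close>

lemma permutability_witness:
  assumes "partition_on {1..N} \<pi>"
  shows "\<exists>d m \<sigma>. (\<forall>j\<in>{1..d}. \<sigma> j permutes {1..m}) \<and>
     contains_partition (perm_partition m d \<sigma>) \<pi>"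
proof -
  have U: "\<Union>\<pi> = {1..N}" and D: "disjoint \<pi>" and NE: "{} \<notin> \<pi>"
    using assms by (auto simp: partition_on_def)
  have "finite \<pi>" using assms by (meson finite_atLeastAtMost finite_elements)
  define m where "m = card \<pi>"
  obtain b where b: "bij_betw b {1..m} \<pi>"
    using ex_bij_betw_nat_finite_1[OF \<open>finite \<pi>\<close>] m_def by blast
  have "\<exists>i\<in>{1..m}. j \<in> b i" if "j \<in> {1..N}" for j
    using that U b by (metis UnionE bij_betw_imp_surj_on imageE)
  then obtain g where g: "\<And>j. j \<in> {1..N} \<Longrightarrow> g j \<in> {1..m} \<and> j \<in> b (g j)" by metis
  have bU: "j \<in> b i \<longleftrightarrow> j \<in> {1..N} \<and> g j = i" if i: "i \<in> {1..m}" for i j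
  proof -
    have "j \<in> {1..N}" if "j \<in> b i" using that i U b bij_betwE by fastforce
    moreover have "g j = i" if "j \<in> b i" "j \<in> {1..N}"
    proof (rule ccontr)
      assume "g j \<noteq> i"
      then have "b (g j) \<noteq> b i" using b g[OF that(2)] i by (metis bij_betw_def inj_on_def)
      moreover have "b (g j) \<in> \<pi>" "b i \<in> \<pi>" using b g[OF that(2)] i bij_betwE by blast+
      ultimately have "b (g j) \<inter> b i = {}" using D by (meson disjointD)
      then show False using g[OF that(2)] that by blast
    qed
    ultimately show ?thesis using g by blast
  qed
  define h where "h j = j * m + g j" for j
  define f where "f x = (x - 1) div m" for x
  define S where "S = h ` {1..N}"
  let ?P = "perm_partition m N (\<lambda>_. id)"
  have fT: "f (j * m + i) = j" if "i \<in> {1..m}" for i j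
  proof -
    have "j * m + i - 1 = (i - 1) + j * m" "i - 1 < m" using that by auto
    then show ?thesis unfolding f_def by simp
  qed
  have fh: "f (h j) = j" if "j \<in> {1..N}" for j using fT g that by (simp add: h_def)
  have bij: "bij_betw f S {1..N}"
    by (rule bij_betw_byWitness[where f' = h]) (auto simp: S_def fh simp del: One_nat_def)
  have mono: "strict_mono_on S f"
  proof (rule strict_mono_onI)
    fix x y assume xy: "x \<in> S" "y \<in> S" "x < y"
    have "f x \<le> f y" unfolding f_def using xy by (intro div_le_mono) simp
    moreover have "f x \<noteq> f y" using bij xy by (auto simp: bij_betw_def inj_on_def)
    ultimately show "f x < f y" by simp
  qed
  define T where "T i = insert i {j * m + id i | j. j \<in> {1..N}}" for i
  have ST: "S \<inter> T i = h ` b i" if i: "i \<in> {1..m}" for i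
  proof (intro set_eqI iffI)
    fix x assume x: "x \<in> S \<inter> T i"
    then obtain j where j: "j \<in> {1..N}" "x = h j" by (auto simp: S_def)
    have "\<exists>k. x = k * m + i" using x unfolding T_def by (auto intro: exI[of _ 0])
    then obtain k where k: "x = k * m + i" by blast
    have "k = j" using fT[OF i] fh[OF j(1)] k j by metis
    then have "g j = i" using k j by (simp add: h_def)
    then show "x \<in> h ` b i" using bU[OF i] j by blast
  next
    fix x assume "x \<in> h ` b i"
    then show "x \<in> S \<inter> T i" using bU[OF i] by (auto simp: S_def T_def h_def)
  qed
  have P: "?P = T ` {1..m}" by (simp add: perm_partition_def T_def)
  have SP: "S \<subseteq> \<Union>?P"
  proof
    fix x assume "x \<in> S"
    then obtain j where "j \<in> {1..N}" "x = h j" by (auto simp: S_def)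
    then show "x \<in> \<Union>?P" using g unfolding P T_def h_def by auto
  qed
  have ne: "b i \<noteq> {}" if "i \<in> {1..m}" for i using b NE that bij_betwE by metis
  have "restrict_partition S ?P = (\<lambda>i. h ` b i) ` {1..m} - {{}}"
    unfolding restrict_partition_def P image_image using ST by auto
  also have "\<dots> = (\<lambda>i. h ` b i) ` {1..m}" using ne by auto
  finally have "(`) f ` restrict_partition S ?P = (\<lambda>i. (\<lambda>j. f (h j)) ` b i) ` {1..m}"
    by (simp add: image_image)
  also have "\<dots> = b ` {1..m}"
  proof (rule image_cong)
    fix i assume "i \<in> {1..m}"
    then have "\<forall>j\<in>b i. f (h j) = j" using bU fh by blast
    then show "(\<lambda>j. f (h j)) ` b i = b i" by simp
  qed simp
  also have "\<dots> = \<pi>" using b by (simp add: bij_betw_def)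
  finally have "contains_partition ?P \<pi>"
    unfolding contains_partition_def using SP bij mono U by metis
  moreover have "\<forall>j\<in>{1..N}. id permutes {1..m}" by (simp add: permutes_id)
  ultimately show ?thesis by (intro exI[of _ N] exI[of _ m] exI[of _ "\<lambda>_. id"]) blast
qed

end

theory Submission
  imports Defs
begin

text \<open>Let \<open>d = pm(\<pi>)\<close>. A set partition avoiding \<open>\<pi>\<close> avoids some \<open>P = [\<sigma>\<^sub>1, \<dots>, \<sigma>\<^sub>d]\<close>; let \<open>d \<ge> 1\<close>. Cut
  \<open>[n]\<close> into \<open>k\<close> intervals of length about \<open>n/k\<close>, where \<open>k\<close> is a power of two close to \<open>n\<^bsup>1/d\<^esup>\<close>. The traces
  of the blocks on the \<open>k\<close> intervals form a hypergraph on \<open>k\<close> ordered vertices that avoids \<open>P\<close>. By a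
  Marcus-Tardos argument its edges have total size \<open>O(k\<^bsup>d\<^esup>) = O(n)\<close>, and by repeated halving of
  the vertex set there are at most \<open>exp(O(n))\<close> such hypergraphs. With multiplicities of the edges there
  are still at most \<open>exp(O(n))\<close> possibilities, and then each of the \<open>n\<close> points has to be assigned to one of
  the at most \<open>n/k + 1 = O(n\<^bsup>1 - 1/d\<^esup>)\<close> blocks that meet its interval.\<close>

section \<open>Unshattered arrays\<close>

text \<open>The choice of \<open>k\<close> balances two costs. Describing the hypergraph costs
  exp(O(\<open>k ^ d\<close>)), which stays exponential in \<open>n\<close> only for
  \<open>k\<close> up to order n^(1/d); placing the points costs about (n/k)^n, which favours large
  \<open>k\<close>. A power of two lets halving end at one vertex. Halving needs a bound on the
  total size of the edges and not just on their number, since an edge \<open>E\<close> can have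
  about \<open>4 ^ card E\<close> preimages. For edges of a fixed size the extremal bound comes from
  arrays of increasing tuples. There one does not fix a pattern but assumes that for every choice of
  \<open>d + 1\<close> coordinates some pattern of \<open>m\<close> points is missing. This form
  passes directly to arrays with one coordinate less, which drives the induction on the dimension.
  The resulting constant depends on the edge size, so large edges need another argument: they are
  chopped into chunks of bounded size, and \<open>d + 1\<close> points are selected from each chunk.
  Chopping relies on the pattern having two rows, so \<open>d = 0\<close> is separate: there
  \<open>P\<close> consists of \<open>m\<close> singletons, and avoiding it merely bounds the number
  of blocks.\<close>

definition rank_below :: "nat \<Rightarrow> (nat \<Rightarrow> nat) \<Rightarrow> nat \<Rightarrow> nat" where
  "rank_below m s a = card {b. b < m \<and> s b < s a}"

lemma rank_below_less: "a < m \<Longrightarrow> rank_below m s a < m"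
  unfolding rank_below_def
  using psubset_card_mono[of "{..<m}" "{b. b < m \<and> s b < s a}"] by auto

lemma rank_below_mono: "a < m \<Longrightarrow> s a < s b \<Longrightarrow> rank_below m s a < rank_below m s b"
  unfolding rank_below_def by (rule psubset_card_mono) auto

lemma sorted_list_of_set_nth_mono:
  "finite X \<Longrightarrow> a < b \<Longrightarrow> b < card X \<Longrightarrow> sorted_list_of_set X ! a < sorted_list_of_set X ! b"
  for X :: "nat set"
  using sorted_wrt_nth_less[OF strict_sorted_list_of_set[of X], of a b] by simp

lemma sorted_list_of_set_nth_mem:
  "finite X \<Longrightarrow> a < card X \<Longrightarrow> sorted_list_of_set X ! a \<in> X"
  using nth_mem[of a "sorted_list_of_set X"] by simp

text \<open>Only the order of the scores matters, so ranks can serve as positions in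
  \<open>X\<close>. Equal scores share an element, which is harmless because only strict comparisons
  must be kept.\<close>

lemma ex_order_embedding:
  fixes X :: "nat set" and s :: "nat \<Rightarrow> nat"
  assumes "finite X" "m \<le> card X"
  shows "\<exists>h. h ` {..<m} \<subseteq> X \<and> (\<forall>a<m. \<forall>b<m. s a < s b \<longrightarrow> h a < h b)"
proof (intro exI conjI allI impI)
  let ?h = "\<lambda>a. sorted_list_of_set X ! rank_below m s a"
  show "?h ` {..<m} \<subseteq> X"
  proof (intro image_subsetI sorted_list_of_set_nth_mem[OF assms(1)])
    fix a assume "a \<in> {..<m}"
    then show "rank_below m s a < card X" using rank_below_less[of a m s] assms(2) by simp
  qed
  fix a b assume "a < m" "b < m" "s a < s b"
  then show "?h a < ?h b"
    using assms rank_below_less[of b m s]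
    by (intro sorted_list_of_set_nth_mono rank_below_mono) auto
qed

text \<open>Ties in \<open>s\<close> impose nothing, and different coordinates are never compared.
  Quantifying over all \<open>s\<close> makes a pattern on \<open>insert i J\<close> the same as a
  pattern on \<open>J\<close> plus an arbitrary order in direction \<open>i\<close>.\<close>

definition shatters :: "('i \<Rightarrow> nat) set \<Rightarrow> 'i set \<Rightarrow> nat \<Rightarrow> bool" where
  "shatters A J m \<longleftrightarrow> (\<forall>s :: 'i \<Rightarrow> nat \<Rightarrow> nat. \<exists>p. p ` {..<m} \<subseteq> A \<and>
     (\<forall>j\<in>J. \<forall>a<m. \<forall>b<m. s j a < s j b \<longrightarrow> p a j < p b j))"

lemma shattersD:
  fixes s :: "'i \<Rightarrow> nat \<Rightarrow> nat"
  assumes "shatters A J m"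
  shows "\<exists>p. p ` {..<m} \<subseteq> A \<and> (\<forall>j\<in>J. \<forall>a<m. \<forall>b<m. s j a < s j b \<longrightarrow> p a j < p b j)"
  using assms[unfolded shatters_def, THEN spec[of _ s]] .

lemma div_less_imp_less: "x div t < y div t \<Longrightarrow> x < y" for x y t :: nat
  by (meson div_le_mono not_le)

text \<open>Points in different boxes are ordered as their boxes are, so any point may represent its
  box.\<close>

lemma shatters_contract:
  assumes "shatters D J m" and lift: "\<And>B. B \<in> D \<Longrightarrow> \<exists>f\<in>A. \<forall>j\<in>J. f j div t = B j"
  shows "shatters A J m"
  unfolding shatters_def
proof
  fix s :: "_ \<Rightarrow> nat \<Rightarrow> nat"
  obtain p where p: "p ` {..<m} \<subseteq> D \<and>
      (\<forall>j\<in>J. \<forall>a<m. \<forall>b<m. s j a < s j b \<longrightarrow> p a j < p b j)"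
    using shattersD[OF assms(1), of s] ..
  have "\<forall>a\<in>{..<m}. \<exists>f. f \<in> A \<and> (\<forall>j\<in>J. f j div t = p a j)"
  proof
    fix a assume "a \<in> {..<m}"
    then have "p a \<in> D" by (rule subsetD[OF conjunct1[OF p] imageI])
    then show "\<exists>f. f \<in> A \<and> (\<forall>j\<in>J. f j div t = p a j)" using lift[of "p a"] by blast
  qed
  from bchoice[OF this] obtain f
    where f: "\<forall>a\<in>{..<m}. f a \<in> A \<and> (\<forall>j\<in>J. f a j div t = p a j)" ..
  have less: "f a j < f b j" if "j \<in> J" "a < m" "b < m" "s j a < s j b" for a b j
  proof (rule div_less_imp_less)
    show "f a j div t < f b j div t" using f p that by simp
  qed
  have sub: "f ` {..<m} \<subseteq> A" using f by (intro image_subsetI) simp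
  show "\<exists>p. p ` {..<m} \<subseteq> A \<and> (\<forall>j\<in>J. \<forall>a<m. \<forall>b<m. s j a < s j b \<longrightarrow> p a j < p b j)"
    by (intro exI[of _ f] conjI ballI allI impI sub less)
qed

text \<open>The lifting hypothesis lets boxes of \<open>D\<close> and values in \<open>X\<close> be
  combined freely, so the order in direction \<open>i\<close> can be prescribed independently of the
  order in the directions of \<open>J\<close>.\<close>

lemma shatters_insert:
  assumes "shatters D J m" "finite X" "m \<le> card X"
    and lift: "\<And>B x. B \<in> D \<Longrightarrow> x \<in> X \<Longrightarrow> \<exists>f\<in>A. f i = x \<and> (\<forall>j\<in>J. f j div t = B j)"
  shows "shatters A (insert i J) m"
  unfolding shatters_def
proof
  fix s :: "_ \<Rightarrow> nat \<Rightarrow> nat"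
  obtain p where p: "p ` {..<m} \<subseteq> D \<and>
      (\<forall>j\<in>J. \<forall>a<m. \<forall>b<m. s j a < s j b \<longrightarrow> p a j < p b j)"
    using shattersD[OF assms(1), of s] ..
  obtain h where h: "h ` {..<m} \<subseteq> X \<and> (\<forall>a<m. \<forall>b<m. s i a < s i b \<longrightarrow> h a < h b)"
    using ex_order_embedding[OF assms(2,3), of "s i"] ..
  have "\<forall>a\<in>{..<m}. \<exists>f. f \<in> A \<and> f i = h a \<and> (\<forall>j\<in>J. f j div t = p a j)"
  proof
    fix a assume a: "a \<in> {..<m}"
    have "p a \<in> D" by (rule subsetD[OF conjunct1[OF p] imageI[OF a]])
    moreover have "h a \<in> X" by (rule subsetD[OF conjunct1[OF h] imageI[OF a]])
    ultimately show "\<exists>f. f \<in> A \<and> f i = h a \<and> (\<forall>j\<in>J. f j div t = p a j)"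
      using lift[of "p a" "h a"] by blast
  qed
  from bchoice[OF this] obtain f
    where f: "\<forall>a\<in>{..<m}. f a \<in> A \<and> f a i = h a \<and> (\<forall>j\<in>J. f a j div t = p a j)" ..
  have less: "f a j < f b j" if "j \<in> J" "a < m" "b < m" "s j a < s j b" for a b j
  proof (rule div_less_imp_less)
    show "f a j div t < f b j div t" using f p that by simp
  qed
  have less_i: "f a i < f b i" if "a < m" "b < m" "s i a < s i b" for a b
    using f h that by simp
  have sub: "f ` {..<m} \<subseteq> A" using f by (intro image_subsetI) simp
  show "\<exists>p. p ` {..<m} \<subseteq> A \<and>
      (\<forall>j\<in>insert i J. \<forall>a<m. \<forall>b<m. s j a < s j b \<longrightarrow> p a j < p b j)"
  proof (intro exI[of _ f] conjI ballI allI impI sub)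
    fix j a b assume "j \<in> insert i J" "a < m" "b < m" "s j a < s j b"
    then show "f a j < f b j" using less[of j a b] less_i[of a b] by (cases "j = i") auto
  qed
qed

lemma card_PiE_values_le:
  assumes "finite I" "F \<subseteq> PiE I (\<lambda>_. {..<k::nat})" "\<And>i. i \<in> I \<Longrightarrow> card ((\<lambda>f. f i) ` F) \<le> M"
  shows "card F \<le> M ^ card I"
proof -
  have fin: "finite F" using assms(1,2) by (meson finite_PiE finite_lessThan finite_subset)
  have "F \<subseteq> PiE I (\<lambda>i. (\<lambda>f. f i) ` F)" using assms(2) by (auto simp: PiE_iff)
  then have "card F \<le> card (PiE I (\<lambda>i. (\<lambda>f. f i) ` F))"
    using assms(1) fin by (intro card_mono finite_PiE) auto
  also have "\<dots> = (\<Prod>i\<in>I. card ((\<lambda>f. f i) ` F))" using assms(1) by (rule card_PiE)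
  also have "\<dots> \<le> (\<Prod>i\<in>I. M)" by (rule prod_mono) (use assms(3) in auto)
  finally show ?thesis by simp
qed

text \<open>The Marcus-Tardos step: a box of the coarse grid is wide if in some direction its points take
  at least \<open>m\<close> values. Narrow boxes hold few points, and wide boxes are rare since for a given
  direction, layer and \<open>m\<close> values they form an unshattered array of lower dimension.\<close>

lemma card_le_coarse:
  fixes A :: "('i \<Rightarrow> nat) set"
  assumes I: "finite I" and A: "A \<subseteq> PiE I (\<lambda>_. {..<k})" and t: "t > 0"
    and unsh: "\<And>J. J \<subseteq> I \<Longrightarrow> card J = Suc (Suc d) \<Longrightarrow> \<not> shatters A J m"
    and k': "k' = k div t + 1"
    and IH: "\<And>i D. i \<in> I \<Longrightarrow> D \<subseteq> PiE (I - {i}) (\<lambda>_. {..<k'}) \<Longrightarrow>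
      (\<And>J. J \<subseteq> I - {i} \<Longrightarrow> card J = Suc d \<Longrightarrow> \<not> shatters D J m) \<Longrightarrow> card D \<le> c i * k' ^ d"
  defines "con \<equiv> \<lambda>f. \<lambda>i\<in>I. f i div t"
  shows "card A \<le> m ^ card I * card (con ` A) + t ^ card I * (\<Sum>i\<in>I. k' * (2 ^ t * (c i * k' ^ d)))"
proof -
  have finA: "finite A" using A I by (meson finite_PiE finite_lessThan finite_subset)
  define fib where "fib B = {f \<in> A. con f = B}" for B
  define vals where "vals B i = (\<lambda>f. f i) ` fib B" for B i
  have finfib: "finite (fib B)" for B using finA by (simp add: fib_def)
  have fibsub: "fib B \<subseteq> PiE I (\<lambda>_. {..<k})" for B using A by (auto simp: fib_def)
  have vals_sub: "vals B i \<subseteq> {t * B i..<t * B i + t}" if "i \<in> I" for B i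
  proof
    fix x assume "x \<in> vals B i"
    then have "x div t = B i" using that by (auto simp: vals_def fib_def con_def)
    then show "x \<in> {t * B i..<t * B i + t}"
      using dividend_less_times_div[OF t, of x] times_div_less_eq_dividend[of t x] by auto
  qed
  \<comment> \<open>Wide boxes are classified by direction, layer and a whole set \<open>X\<close>
    of values, so that all boxes of one class realise the same values. A layer has at most
    \<open>2 ^ t\<close> candidates for \<open>X\<close>.\<close>
  define W where "W i v X = {B \<in> con ` A. B i = v \<and> X \<subseteq> vals B i}" for i v X
  define XS where "XS v = {X \<in> Pow {t * v..<t * v + t}. m \<le> card X}" for v :: nat
  define Wide where "Wide = {B \<in> con ` A. \<exists>i\<in>I. m \<le> card (vals B i)}"
  have conlt: "con f \<in> PiE I (\<lambda>_. {..<k'})" if "f \<in> A" for f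
  proof -
    have "f i < k" if "i \<in> I" for i using A \<open>f \<in> A\<close> that by auto
    then show ?thesis using k' by (auto simp: con_def less_Suc_eq_le div_le_mono less_imp_le)
  qed
  have Wsub: "Wide \<subseteq> (\<Union>i\<in>I. \<Union>v\<in>{..<k'}. \<Union>X\<in>XS v. W i v X)"
  proof
    fix B assume B: "B \<in> Wide"
    then obtain i where i: "i \<in> I" "m \<le> card (vals B i)" "B \<in> con ` A" by (auto simp: Wide_def)
    have "B i < k'" using i(1,3) conlt by auto
    moreover have "vals B i \<in> XS (B i)" using vals_sub[OF i(1)] i(2) by (auto simp: XS_def)
    moreover have "B \<in> W i (B i) (vals B i)" using i by (auto simp: W_def)
    ultimately show "B \<in> (\<Union>i\<in>I. \<Union>v\<in>{..<k'}. \<Union>X\<in>XS v. W i v X)"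
      by (intro UN_I[OF i(1)] UN_I[of "B i"] UN_I[of "vals B i"]) auto
  qed
  have XSfin: "finite (XS v)" and XScard: "card (XS v) \<le> 2 ^ t" for v
  proof -
    show "finite (XS v)" by (simp add: XS_def)
    have "card (XS v) \<le> card (Pow {t * v..<t * v + t})" by (rule card_mono) (auto simp: XS_def)
    then show "card (XS v) \<le> 2 ^ t" by (simp add: card_Pow)
  qed
  have Wcard: "card (W i v X) \<le> c i * k' ^ d" if i: "i \<in> I" and X: "X \<in> XS v" for i v X
  proof -
    \<comment> \<open>Dropping coordinate \<open>i\<close> loses nothing, since it equals
      \<open>v\<close> on the whole class.\<close>
    let ?r = "\<lambda>B. restrict B (I - {i})"
    have inj: "inj_on ?r (W i v X)"
    proof (rule inj_onI)
      fix B B' assume BB: "B \<in> W i v X" "B' \<in> W i v X" "?r B = ?r B'"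
      have "B \<in> PiE I (\<lambda>_. {..<k'})" "B' \<in> PiE I (\<lambda>_. {..<k'})" using BB conlt by (auto simp: W_def)
      moreover have "B j = B' j" if "j \<in> I" for j
      proof (cases "j = i")
        case True then show ?thesis using BB by (auto simp: W_def)
      next
        case False then show ?thesis using BB(3) that by (metis DiffI restrict_apply' singletonD)
      qed
      ultimately show "B = B'" by (rule PiE_ext)
    qed
    have sub: "?r ` W i v X \<subseteq> PiE (I - {i}) (\<lambda>_. {..<k'})"
    proof -
      have "?r B \<in> PiE (I - {i}) (\<lambda>_. {..<k'})" if "B \<in> con ` A" for B
      proof -
        have "B \<in> PiE I (\<lambda>_. {..<k'})" using that conlt by auto
        then show ?thesis by (auto simp: PiE_iff)
      qed
      moreover have "W i v X \<subseteq> con ` A" by (auto simp: W_def)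
      ultimately show ?thesis by blast
    qed
    have "\<not> shatters (?r ` W i v X) J m" if J: "J \<subseteq> I - {i}" "card J = Suc d" for J
    proof
      assume sh: "shatters (?r ` W i v X) J m"
      have "shatters A (insert i J) m"
      proof (rule shatters_insert[OF sh, where X = X and t = t])
        show "finite X" using X by (auto simp: XS_def intro: finite_subset)
        show "m \<le> card X" using X by (auto simp: XS_def)
        fix D x assume D: "D \<in> ?r ` W i v X" and x: "x \<in> X"
        then obtain B where B: "B \<in> W i v X" "D = ?r B" by blast
        then have "x \<in> vals B i" using x by (auto simp: W_def)
        then obtain f where f: "f \<in> A" "con f = B" "f i = x" by (auto simp: vals_def fib_def)
        have "f j div t = D j" if "j \<in> J" for j
        proof -
          have "j \<in> I - {i}" using that J by auto
          then show ?thesis using f(2) B(2) by (auto simp: con_def)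
        qed
        then show "\<exists>f\<in>A. f i = x \<and> (\<forall>j\<in>J. f j div t = D j)" using f by blast
      qed
      moreover have "card (insert i J) = Suc (Suc d)"
        using J I by (subst card_insert_disjoint) (auto intro: finite_subset)
      ultimately show False using unsh[of "insert i J"] J i by blast
    qed
    then have "card (?r ` W i v X) \<le> c i * k' ^ d" using IH[OF i sub] by blast
    then show ?thesis using card_image[OF inj] by simp
  qed
  have finW: "finite (W i v X)" for i v X using finA by (simp add: W_def)
  have cW: "card Wide \<le> (\<Sum>i\<in>I. k' * (2 ^ t * (c i * k' ^ d)))"
  proof -
    have "card Wide \<le> card (\<Union>i\<in>I. \<Union>v\<in>{..<k'}. \<Union>X\<in>XS v. W i v X)"
      by (rule card_mono[OF _ Wsub]) (intro finite_UN_I I XSfin finW finite_lessThan)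
    also have "\<dots> \<le> (\<Sum>i\<in>I. card (\<Union>v\<in>{..<k'}. \<Union>X\<in>XS v. W i v X))" using I by (rule card_UN_le)
    also have "\<dots> \<le> (\<Sum>i\<in>I. k' * (2 ^ t * (c i * k' ^ d)))"
    proof (rule sum_mono)
      fix i assume i: "i \<in> I"
      have "card (\<Union>v\<in>{..<k'}. \<Union>X\<in>XS v. W i v X) \<le> (\<Sum>v\<in>{..<k'}. card (\<Union>X\<in>XS v. W i v X))"
        by (rule card_UN_le) simp
      also have "\<dots> \<le> (\<Sum>v\<in>{..<k'}. 2 ^ t * (c i * k' ^ d))"
      proof (rule sum_mono)
        fix v
        have "card (\<Union>X\<in>XS v. W i v X) \<le> (\<Sum>X\<in>XS v. card (W i v X))" using XSfin by (rule card_UN_le)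
        also have "\<dots> \<le> (\<Sum>X\<in>XS v. c i * k' ^ d)" by (rule sum_mono) (use Wcard i in blast)
        also have "\<dots> \<le> 2 ^ t * (c i * k' ^ d)" using XScard[of v] by (simp add: mult_le_mono1)
        finally show "card (\<Union>X\<in>XS v. W i v X) \<le> 2 ^ t * (c i * k' ^ d)" .
      qed
      finally show "card (\<Union>v\<in>{..<k'}. \<Union>X\<in>XS v. W i v X) \<le> k' * (2 ^ t * (c i * k' ^ d))" by simp
    qed
    finally show ?thesis .
  qed
  have fibcard: "card (fib B) \<le> m ^ card I + (if B \<in> Wide then t ^ card I else 0)" if "B \<in> con ` A" for B
  proof (cases "B \<in> Wide")
    case True
    have "card (fib B) \<le> t ^ card I"
    proof (rule card_PiE_values_le[OF I fibsub])
      fix i assume "i \<in> I"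
      then have "card (vals B i) \<le> card {t * B i..<t * B i + t}" by (intro card_mono vals_sub) auto
      then show "card ((\<lambda>f. f i) ` fib B) \<le> t" by (simp add: vals_def)
    qed
    then show ?thesis using True by simp
  next
    case False
    have "card (fib B) \<le> m ^ card I"
    proof (rule card_PiE_values_le[OF I fibsub])
      fix i assume "i \<in> I"
      then have "\<not> m \<le> card (vals B i)" using False that by (auto simp: Wide_def)
      then show "card ((\<lambda>f. f i) ` fib B) \<le> m" by (simp add: vals_def)
    qed
    then show ?thesis using False by simp
  qed
  have "card A = (\<Sum>B\<in>con ` A. card (fib B))"
    using sum.image_gen[OF finA, of "\<lambda>_. 1::nat" con] by (simp add: fib_def)
  also have "\<dots> \<le> (\<Sum>B\<in>con ` A. m ^ card I + (if B \<in> Wide then t ^ card I else 0))"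
  proof (rule sum_mono)
    fix B assume "B \<in> con ` A"
    then show "card (fib B) \<le> m ^ card I + (if B \<in> Wide then t ^ card I else 0)" by (rule fibcard)
  qed
  also have "\<dots> = (\<Sum>B\<in>con ` A. m ^ card I) + (\<Sum>B\<in>con ` A. if B \<in> Wide then t ^ card I else 0)"
    by (rule sum.distrib)
  also have "\<dots> = (\<Sum>B\<in>con ` A. m ^ card I) + (\<Sum>B\<in>con ` A \<inter> Wide. t ^ card I)"
    using finA by (subst sum.inter_restrict) auto
  also have "\<dots> = m ^ card I * card (con ` A) + t ^ card I * card Wide"
  proof -
    have "con ` A \<inter> Wide = Wide" by (auto simp: Wide_def)
    then show ?thesis by (simp only: sum_constant of_nat_id mult.commute)
  qed
  finally show ?thesis using mult_le_mono2[OF cW, of "t ^ card I"] by linarith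
qed

text \<open>For a positive exponent, coarsening gives f(k) \<le> M f(k') + c' k'^(d+1) with k' about
  k/t, which contracts once \<open>t\<close> is a large enough multiple of \<open>M\<close>. With
  exponent 0 nothing contracts, so that case is direct: a coordinate with more than \<open>m\<close>
  values is shattered by itself.\<close>

lemma unshattered_card_le:
  fixes I :: "'i set"
  assumes "m > 0" "finite I"
  shows "\<exists>C. \<forall>k\<ge>1. \<forall>A. A \<subseteq> PiE I (\<lambda>_. {..<k}) \<longrightarrow>
    (\<forall>J\<subseteq>I. card J = Suc d \<longrightarrow> \<not> shatters A J m) \<longrightarrow> card A \<le> C * k ^ d"
  using assms(2)
proof (induction d arbitrary: I)
  case 0
  have "card A \<le> m ^ card I * k ^ 0"
    if A: "A \<subseteq> PiE I (\<lambda>_. {..<k})" and u: "\<forall>J\<subseteq>I. card J = Suc 0 \<longrightarrow> \<not> shatters A J m" for k A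
  proof -
    have "card A \<le> m ^ card I"
    proof (rule card_PiE_values_le[OF 0 A], rule ccontr)
      fix i assume i: "i \<in> I" and "\<not> card ((\<lambda>f. f i) ` A) \<le> m"
      moreover have "finite A" using A 0 by (meson finite_PiE finite_lessThan finite_subset)
      moreover have "shatters {\<lambda>_. 0 :: nat} {} m"
        unfolding shatters_def by (intro allI exI[of _ "\<lambda>_ _. 0"]) auto
      ultimately have "shatters A {i} m"
        by (intro shatters_insert[where D = "{\<lambda>_. 0}" and X = "(\<lambda>f. f i) ` A" and t = 0]) auto
      then show False using u i by auto
    qed
    then show ?thesis by simp
  qed
  then show ?case by blast
next
  case (Suc d)
  have "\<forall>i\<in>I. \<exists>C. \<forall>k\<ge>1. \<forall>A. A \<subseteq> PiE (I - {i}) (\<lambda>_. {..<k}) \<longrightarrow>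
    (\<forall>J\<subseteq>I - {i}. card J = Suc d \<longrightarrow> \<not> shatters A J m) \<longrightarrow> card A \<le> C * k ^ d"
    by (intro ballI Suc.IH finite_Diff Suc.prems)
  from bchoice[OF this] obtain c where c: "\<forall>i\<in>I. \<forall>k\<ge>1. \<forall>A. A \<subseteq> PiE (I - {i}) (\<lambda>_. {..<k}) \<longrightarrow>
    (\<forall>J\<subseteq>I - {i}. card J = Suc d \<longrightarrow> \<not> shatters A J m) \<longrightarrow> card A \<le> c i * k ^ d" ..
  define M where "M = m ^ card I"
  have M: "M \<ge> 1" using assms(1) by (simp add: M_def Suc_leI)
  \<comment> \<open>For \<open>k \<ge> t\<close> one has
    \<open>t * k' \<le> k + t \<le> 2 * k\<close>, so the factor 4 yields
    \<open>2 * M * k' \<le> k\<close>: half of the budget for each term of the recursion.\<close>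
  define t where "t = 4 * M"
  have t: "t \<ge> 4" using M by (simp add: t_def)
  define c' where "c' = t ^ card I * (\<Sum>i\<in>I. 2 ^ t * c i)"
  \<comment> \<open>The second summand covers \<open>k < t\<close>, where even the full grid has at
    most \<open>t ^ card I\<close> points.\<close>
  define C where "C = c' + t ^ card I"
  have "card A \<le> C * k ^ Suc d"
    if "k \<ge> 1" "A \<subseteq> PiE I (\<lambda>_. {..<k})" "\<forall>J\<subseteq>I. card J = Suc (Suc d) \<longrightarrow> \<not> shatters A J m" for k A
    using that
  proof (induction k arbitrary: A rule: less_induct)
    case (less k)
    show ?case
    proof (cases "k < t")
      case True
      have "card A \<le> card (PiE I (\<lambda>_. {..<k}))"
        using less.prems Suc.prems by (intro card_mono finite_PiE) auto
      also have "\<dots> = k ^ card I" using Suc.prems by (simp add: card_PiE)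
      also have "\<dots> \<le> t ^ card I" using True by (simp add: power_mono)
      also have "\<dots> \<le> C * 1" by (simp add: C_def)
      also have "\<dots> \<le> C * k ^ Suc d" by (rule mult_le_mono2) (use less.prems(1) in \<open>simp add: Suc_leI\<close>)
      finally show ?thesis .
    next
      case False
      define k' where "k' = k div t + 1"
      define con where "con f = (\<lambda>i\<in>I. f i div t)" for f :: "'i \<Rightarrow> nat"
      have kt: "t * (k div t) \<le> k" by simp
      have "4 * M * k' \<le> 2 * k" using kt False by (simp add: k'_def t_def algebra_simps)
      then have Mk: "2 * M * k' \<le> k" by simp
      then have k'k: "2 * k' \<le> k" using mult_le_mono1[OF M, of "2 * k'"] by (simp add: algebra_simps)
      have k'1: "k' \<ge> 1" "k' < k" using k'k by (auto simp: k'_def)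
      have pow: "2 * M * k' ^ Suc d \<le> k ^ Suc d"
      proof -
        have "2 * M * k' ^ Suc d \<le> (2 * M) ^ Suc d * k' ^ Suc d"
          using M by (intro mult_le_mono1 self_le_power) auto
        also have "\<dots> = (2 * M * k') ^ Suc d" by (simp only: power_mult_distrib)
        also have "\<dots> \<le> k ^ Suc d" using Mk by (rule power_mono) simp
        finally show ?thesis .
      qed
      have "con ` A \<subseteq> PiE I (\<lambda>_. {..<k'})"
      proof
        fix B assume "B \<in> con ` A"
        then obtain f where f: "f \<in> A" "B = con f" by blast
        have "f i < k" if "i \<in> I" for i using less.prems(2) f that by auto
        then show "B \<in> PiE I (\<lambda>_. {..<k'})"
          by (auto simp: f con_def k'_def less_Suc_eq_le div_le_mono less_imp_le)
      qed
      moreover have "\<not> shatters (con ` A) J m" if "J \<subseteq> I" "card J = Suc (Suc d)" for J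
      proof
        assume "shatters (con ` A) J m"
        then have "shatters A J m"
        proof (rule shatters_contract[where t = t])
          fix B assume "B \<in> con ` A"
          then obtain f where "f \<in> A" "B = con f" by blast
          moreover have "\<forall>j\<in>J. f j div t = con f j" using \<open>J \<subseteq> I\<close> by (auto simp: con_def)
          ultimately show "\<exists>f\<in>A. \<forall>j\<in>J. f j div t = B j" by blast
        qed
        then show False using less.prems(3) that by blast
      qed
      ultimately have cA: "card (con ` A) \<le> C * k' ^ Suc d" using less.IH[OF k'1(2) k'1(1)] by blast
      have "card A \<le> m ^ card I * card (con ` A) +
          t ^ card I * (\<Sum>i\<in>I. k' * (2 ^ t * (c i * k' ^ d)))"
        unfolding con_def
      proof (rule card_le_coarse[OF Suc.prems less.prems(2) _ _ k'_def])
        show "t > 0" using t by simp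
        show "\<not> shatters A J m" if "J \<subseteq> I" "card J = Suc (Suc d)" for J
          using less.prems(3) that by blast
        show "card D \<le> c i * k' ^ d" if "i \<in> I" "D \<subseteq> PiE (I - {i}) (\<lambda>_. {..<k'})"
          "\<And>J. J \<subseteq> I - {i} \<Longrightarrow> card J = Suc d \<Longrightarrow> \<not> shatters D J m" for i D
          using c[rule_format, OF that(1) k'1(1) that(2)] that(3) by blast
      qed
      moreover have "t ^ card I * (\<Sum>i\<in>I. k' * (2 ^ t * (c i * k' ^ d))) = c' * k' ^ Suc d"
        by (simp add: c'_def sum_distrib_left sum_distrib_right algebra_simps)
      moreover have "m ^ card I * card (con ` A) \<le> M * (C * k' ^ Suc d)"
        unfolding M_def by (rule mult_le_mono2[OF cA])
      ultimately have "card A \<le> M * (C * k' ^ Suc d) + c' * k' ^ Suc d" by linarith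
      then have "2 * card A \<le> C * (2 * M * k' ^ Suc d) + c' * (2 * k' ^ Suc d)"
        by (simp add: algebra_simps)
      also have "\<dots> \<le> C * k ^ Suc d + C * k ^ Suc d"
      proof (intro add_mono mult_le_mono2 mult_le_mono pow)
        show "c' \<le> C" by (simp add: C_def)
        have "2 * k' ^ Suc d \<le> 2 * M * k' ^ Suc d" using M by (intro mult_le_mono1) simp
        then show "2 * k' ^ Suc d \<le> k ^ Suc d" using pow by (rule le_trans)
      qed
      finally show ?thesis by simp
    qed
  qed
  then show ?case by blast
qed

section \<open>Ordered hypergraphs avoiding a pattern\<close>

text \<open>This is the pattern of a permutation partition: row \<open>j\<close> collects the
  \<open>j\<close>-th points of the \<open>m\<close> members, each row precedes the next, and
  \<open>s j\<close> orders row \<open>j\<close>. Indexing the sets by \<open>\<Omega>\<close> lets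
  equal sets count as different members; the sets may overlap and may have further points.\<close>

definition occurs :: "nat \<Rightarrow> nat \<Rightarrow> (nat \<Rightarrow> nat \<Rightarrow> nat) \<Rightarrow> 'w set \<Rightarrow> ('w \<Rightarrow> nat set) \<Rightarrow> bool" where
  "occurs d m s \<Omega> K \<longleftrightarrow> (\<exists>e x. inj_on e {..<m} \<and> e ` {..<m} \<subseteq> \<Omega> \<and>
     (\<forall>i<m. \<forall>j\<le>d. x i j \<in> K (e i)) \<and>
     (\<forall>i<m. \<forall>i'<m. \<forall>j\<le>d. \<forall>j'\<le>d. j < j' \<or> j = j' \<and> s j i < s j i' \<longrightarrow> x i j < x i' j'))"

lemma occursI:
  assumes "inj_on e {..<m}" "\<And>i. i < m \<Longrightarrow> e i \<in> \<Omega>"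
    and "\<And>i j. i < m \<Longrightarrow> j \<le> d \<Longrightarrow> x i j \<in> K (e i)"
    and "\<And>i i' j j'. i < m \<Longrightarrow> i' < m \<Longrightarrow> j < j' \<Longrightarrow> j' \<le> d \<Longrightarrow> x i j < x i' j'"
    and "\<And>i i' j. i < m \<Longrightarrow> i' < m \<Longrightarrow> j \<le> d \<Longrightarrow> s j i < s j i' \<Longrightarrow> x i j < x i' j"
  shows "occurs d m s \<Omega> K"
  unfolding occurs_def
proof (intro exI[of _ e] exI[of _ x] conjI allI impI image_subsetI)
  fix i i' j j' assume "i < m" "i' < m" "j \<le> d" "j' \<le> d" "j < j' \<or> j = j' \<and> s j i < s j i'"
  then show "x i j < x i' j'" using assms(4)[of i i' j j'] assms(5)[of i i' j] by auto
qed (use assms(1-3) in simp_all)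

lemma occursE:
  assumes "occurs d m s \<Omega> K"
  obtains e x where "inj_on e {..<m}" "\<And>i. i < m \<Longrightarrow> e i \<in> \<Omega>"
    and "\<And>i j. i < m \<Longrightarrow> j \<le> d \<Longrightarrow> x i j \<in> K (e i)"
    and "\<And>i i' j j'. i < m \<Longrightarrow> i' < m \<Longrightarrow> j < j' \<Longrightarrow> j' \<le> d \<Longrightarrow> x i j < x i' j'"
    and "\<And>i i' j. i < m \<Longrightarrow> i' < m \<Longrightarrow> j \<le> d \<Longrightarrow> s j i < s j i' \<Longrightarrow> x i j < x i' j"
proof -
  from assms[unfolded occurs_def] obtain e x where ex: "inj_on e {..<m} \<and> e ` {..<m} \<subseteq> \<Omega> \<and>
     (\<forall>i<m. \<forall>j\<le>d. x i j \<in> K (e i)) \<and>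
     (\<forall>i<m. \<forall>i'<m. \<forall>j\<le>d. \<forall>j'\<le>d. j < j' \<or> j = j' \<and> s j i < s j i' \<longrightarrow> x i j < x i' j')"
    by (elim exE)
  show thesis
  proof (rule that[of e x])
    show "e i \<in> \<Omega>" if "i < m" for i using ex that by auto
  qed (use ex in simp_all)
qed

text \<open>A monotone \<open>\<phi>\<close> reflects strict inequalities, so arbitrary preimages of
  the points are ordered as required, and injectivity of \<open>h\<close> keeps the members
  distinct. This one principle serves subfamilies, smaller edges, halving and traces.\<close>

lemma occurs_lift:
  assumes "occurs d m s G L" "inj_on h G" "\<And>g. g \<in> G \<Longrightarrow> h g \<in> \<Omega>"
    and L: "\<And>g. g \<in> G \<Longrightarrow> L g \<subseteq> \<phi> ` K (h g)" and "mono \<phi>"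
  shows "occurs d m s \<Omega> K"
  using assms(1)
proof (rule occursE)
  fix e x
  assume e: "inj_on e {..<m}" "\<And>i. i < m \<Longrightarrow> e i \<in> G"
    and x: "\<And>i j. i < m \<Longrightarrow> j \<le> d \<Longrightarrow> x i j \<in> L (e i)"
      "\<And>i i' j j'. i < m \<Longrightarrow> i' < m \<Longrightarrow> j < j' \<Longrightarrow> j' \<le> d \<Longrightarrow> x i j < x i' j'"
      "\<And>i i' j. i < m \<Longrightarrow> i' < m \<Longrightarrow> j \<le> d \<Longrightarrow> s j i < s j i' \<Longrightarrow> x i j < x i' j"
  define y where "y i j = (SOME z. z \<in> K (h (e i)) \<and> \<phi> z = x i j)" for i j
  have y: "y i j \<in> K (h (e i)) \<and> \<phi> (y i j) = x i j" if "i < m" "j \<le> d" for i j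
  proof -
    have "\<exists>z. z \<in> K (h (e i)) \<and> \<phi> z = x i j" using subsetD[OF L[OF e(2)[OF that(1)]] x(1)[OF that]] by auto
    then show ?thesis unfolding y_def by (rule someI_ex)
  qed
  have lt: "y i j < y i' j'" if "i < m" "i' < m" "j \<le> d" "j' \<le> d" "x i j < x i' j'" for i i' j j'
  proof -
    have "\<phi> (y i j) < \<phi> (y i' j')" using y that by simp
    then show ?thesis by (rule mono_strict_invE[OF \<open>mono \<phi>\<close>])
  qed
  show ?thesis
  proof (rule occursI[where e = "h \<circ> e" and x = y])
    show "inj_on (h \<circ> e) {..<m}"
      using e assms(2) by (intro comp_inj_on) (auto intro: inj_on_subset)
    show "(h \<circ> e) i \<in> \<Omega>" if "i < m" for i using assms(3)[OF e(2)[OF that]] by simp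
    show "y i j \<in> K ((h \<circ> e) i)" if "i < m" "j \<le> d" for i j using y[OF that] by simp
    show "y i j < y i' j'" if "i < m" "i' < m" "j < j'" "j' \<le> d" for i i' j j'
      using that by (intro lt x(2)) auto
    show "y i j < y i' j" if "i < m" "i' < m" "j \<le> d" "s j i < s j i'" for i i' j
      using that by (intro lt x(3)) auto
  qed
qed

lemma inj_on_sorted_nth: "inj_on (\<lambda>E. \<lambda>j\<in>{..<q}. sorted_list_of_set E ! j) {E :: nat set. finite E \<and> card E = q}"
proof (rule inj_onI)
  fix E F :: "nat set"
  assume "E \<in> {E. finite E \<and> card E = q}" "F \<in> {E. finite E \<and> card E = q}"
    and eq: "(\<lambda>j\<in>{..<q}. sorted_list_of_set E ! j) = (\<lambda>j\<in>{..<q}. sorted_list_of_set F ! j)"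
  then have EF: "finite E" "card E = q" "finite F" "card F = q" by auto
  have "sorted_list_of_set E = sorted_list_of_set F"
  proof (rule nth_equalityI)
    show "length (sorted_list_of_set E) = length (sorted_list_of_set F)" using EF by simp
    fix j assume "j < length (sorted_list_of_set E)"
    then have "j < q" using EF by simp
    then show "sorted_list_of_set E ! j = sorted_list_of_set F ! j"
      using fun_cong[OF eq, of j] by simp
  qed
  then show "E = F" using EF(1,3) set_sorted_list_of_set by metis
qed

text \<open>Shattering does not compare the entries of different tuples in different coordinates. Two extra
  tuples, alternately the highest and the lowest one in consecutive coordinates, separate these
  coordinates.\<close>

lemma uniform_card_le:
  assumes s: "inj_on (s 0) {..<m}"
  shows "\<exists>C. \<forall>k\<ge>1. \<forall>H. H \<subseteq> {E \<in> Pow {..<k}. card E = q} \<longrightarrow> \<not> occurs d m s H (\<lambda>E. E)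
    \<longrightarrow> card H \<le> C * k ^ d"
proof -
  obtain C where C: "\<forall>k\<ge>1. \<forall>A. A \<subseteq> PiE {..<q} (\<lambda>_. {..<k}) \<longrightarrow>
    (\<forall>J\<subseteq>{..<q}. card J = Suc d \<longrightarrow> \<not> shatters A J (m + 2)) \<longrightarrow> card A \<le> C * k ^ d"
    using unshattered_card_le[of "m + 2" "{..<q}" d] by auto
  have "card H \<le> C * k ^ d"
    if k: "k \<ge> 1" and H: "H \<subseteq> {E \<in> Pow {..<k}. card E = q}" and av: "\<not> occurs d m s H (\<lambda>E. E)" for k H
  proof -
    define tup where "tup E = (\<lambda>j\<in>{..<q}. sorted_list_of_set E ! j)" for E :: "nat set"
    have E: "finite E" "card E = q" "E \<subseteq> {..<k}" if "E \<in> H" for E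
      using that H by (auto intro: finite_subset)
    have inj: "inj_on tup H"
      unfolding tup_def by (rule inj_on_subset[OF inj_on_sorted_nth]) (use E in auto)
    have tup_mem: "tup E j \<in> E" if "E \<in> H" "j < q" for E j
      using E(1,2)[OF that(1)] that(2) sorted_list_of_set_nth_mem[of E j] by (simp add: tup_def)
    have tup_less: "tup E j < tup E j'" if "E \<in> H" "j < j'" "j' < q" for E j j'
      using E(1,2)[OF that(1)] that(2,3) sorted_list_of_set_nth_mono[of E j j'] by (simp add: tup_def)
    have sub: "tup ` H \<subseteq> PiE {..<q} (\<lambda>_. {..<k})"
    proof (intro image_subsetI PiE_I)
      fix E j assume "E \<in> H" "j \<in> {..<q}"
      then show "tup E j \<in> {..<k}" using tup_mem[of E j] E(3)[of E] by auto
    qed (simp add: tup_def)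
    have "\<not> shatters (tup ` H) J (m + 2)" if J: "J \<subseteq> {..<q}" "card J = Suc d" for J
    proof
      assume sh: "shatters (tup ` H) J (m + 2)"
      have finJ: "finite J" using J(1) by (rule finite_subset) simp
      define jj where "jj l = sorted_list_of_set J ! l" for l
      have jj_mem: "jj l \<in> J" if "l \<le> d" for l
        using sorted_list_of_set_nth_mem[OF finJ, of l] that J(2) by (simp add: jj_def)
      have jj_less: "jj l < jj l'" if "l < l'" "l' \<le> d" for l l'
        using sorted_list_of_set_nth_mono[OF finJ, of l l'] that J(2) by (simp add: jj_def)
      have jjq: "jj l < q" if "l \<le> d" for l using jj_mem[OF that] J(1) by auto
      have jj_inj: "inj_on jj {..d}"
        by (rule linorder_inj_onI') (use jj_less in \<open>auto simp: neq_iff\<close>)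
      define S where "S = (\<Sum>l\<le>d. \<Sum>i<m. s l i)"
      have sS: "s l i \<le> S" if "l \<le> d" "i < m" for l i
      proof -
        have "s l i \<le> (\<Sum>i<m. s l i)" using that(2) by (intro member_le_sum) auto
        also have "\<dots> \<le> S" unfolding S_def using that(1)
          by (intro member_le_sum[of l "{..d}" "\<lambda>l. \<Sum>i<m. s l i"]) auto
        finally show ?thesis .
      qed
      \<comment> \<open>Tuples \<open>m\<close> and \<open>m + 1\<close> are the separators:
        \<open>m\<close> is highest in even rows and lowest in odd rows, \<open>m + 1\<close> the
        reverse. \<open>Suc\<close> keeps 0 free for the lowest place, and \<open>S + 2\<close>
        exceeds every \<open>Suc (s l i)\<close>.\<close>
      define s' where "s' l i = (if i < m then Suc (s l i) else if (i = m) = even l then S + 2 else 0)"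
        for l i
      \<comment> \<open>Shattering assigns scores to the coordinates in \<open>J\<close>; the
        inverse of \<open>jj\<close> recovers the row from the coordinate.\<close>
      obtain p where p: "p ` {..<m + 2} \<subseteq> tup ` H \<and> (\<forall>j\<in>J. \<forall>a<m + 2. \<forall>b<m + 2.
          s' (inv_into {..d} jj j) a < s' (inv_into {..d} jj j) b \<longrightarrow> p a j < p b j)"
        using shattersD[OF sh, of "\<lambda>j. s' (inv_into {..d} jj j)"] ..
      have p_less: "p a (jj l) < p b (jj l)" if "l \<le> d" "a < m + 2" "b < m + 2" "s' l a < s' l b" for l a b
        using conjunct2[OF p, rule_format, OF jj_mem[OF that(1)] that(2,3)] that(4)
          inv_into_f_f[OF jj_inj, of l] that(1) by simp
      define e where "e a = inv_into H tup (p a)" for a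
      have e: "e a \<in> H" "tup (e a) = p a" if "a < m + 2" for a
      proof -
        have "p a \<in> tup ` H" by (rule subsetD[OF conjunct1[OF p] imageI]) (use that in simp)
        then show "e a \<in> H" "tup (e a) = p a" unfolding e_def by (rule inv_into_into, rule f_inv_into_f)
      qed
      have p_mono: "p a (jj l) < p a (jj l')" if "a < m + 2" "l < l'" "l' \<le> d" for a l l'
        using tup_less[OF e(1)[OF that(1)] jj_less[OF that(2,3)] jjq[OF that(3)]] e(2)[OF that(1)] by simp
      have "occurs d m s H (\<lambda>E. E)"
      proof (rule occursI[where e = e and x = "\<lambda>i l. p i (jj l)"])
        show "inj_on e {..<m}"
        proof (rule inj_onI)
          fix a b assume ab: "a \<in> {..<m}" "b \<in> {..<m}" "e a = e b"
          then have "p a = p b" using e(2)[of a] e(2)[of b] by simp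
          then have "\<not> s 0 a < s 0 b" "\<not> s 0 b < s 0 a"
            using p_less[of 0 a b] p_less[of 0 b a] ab by (auto simp: s'_def)
          then show "a = b" using s ab by (auto simp: inj_on_def)
        qed
        show "e i \<in> H" if "i < m" for i using that by (intro e) simp
        show "p i (jj l) \<in> e i" if "i < m" "l \<le> d" for i l
          using tup_mem[of "e i" "jj l"] e[of i] jjq[OF that(2)] that(1) by simp
        show "p i (jj l) < p i' (jj l)" if "i < m" "i' < m" "l \<le> d" "s l i < s l i'" for i i' l
          using that by (intro p_less) (auto simp: s'_def)
        show "p i (jj l) < p i' (jj l')" if "i < m" "i' < m" "l < l'" "l' \<le> d" for i i' l l'
        proof -
          \<comment> \<open>\<open>u\<close> is the separator that is highest in row
            \<open>l\<close> and hence lowest in row \<open>l + 1\<close>. As its own entries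
            increase, it separates the two rows.\<close>
          define u where "u = (if even l then m else m + 1)"
          have u: "u < m + 2" by (simp add: u_def)
          have "p i (jj l) < p u (jj l)"
            using that u sS[of l i] by (intro p_less) (auto simp: s'_def u_def)
          also have "p u (jj l) < p u (jj (Suc l))" using u that by (intro p_mono) auto
          also have "p u (jj (Suc l)) < p i' (jj (Suc l))"
            using that u by (intro p_less) (auto simp: s'_def u_def)
          also have "p i' (jj (Suc l)) \<le> p i' (jj l')"
            using p_mono[of i' "Suc l" l'] that by (cases "Suc l = l'") auto
          finally show ?thesis .
        qed
      qed
      then show False using av by contradiction
    qed
    then have "card (tup ` H) \<le> C * k ^ d" using C[rule_format, OF k sub] by blast
    then show ?thesis using card_image[OF inj] by simp
  qed
  then show ?thesis by (intro exI[of _ C]) blast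
qed

text \<open>The \<open>Suc d * m\<close> smallest elements of \<open>V\<close> form
  \<open>d + 1\<close> consecutive runs of length \<open>m\<close>, one per row, and
  \<open>i\<close> takes the place in run \<open>j\<close> given by its rank under
  \<open>s j\<close>. The members are distinct because \<open>s 0\<close> is injective and row 0
  lies below all other rows.\<close>

lemma occurs_clique:
  fixes V :: "nat set"
  assumes s: "inj_on (s 0) {..<m}" and V: "finite V" "Suc d * m \<le> card V"
    and G: "\<And>g. g \<subseteq> V \<Longrightarrow> card g = Suc d \<Longrightarrow> g \<in> G"
  shows "occurs d m s G (\<lambda>E. E)"
proof -
  define x where "x i j = sorted_list_of_set V ! (j * m + rank_below m (s j) i)" for i j
  have idx: "j * m + rank_below m (s j) i < card V" if "i < m" "j \<le> d" for i j
  proof -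
    have "j * m + rank_below m (s j) i < Suc j * m" using rank_below_less[OF that(1)] by simp
    also have "\<dots> \<le> Suc d * m" using that(2) by (intro mult_le_mono1) simp
    finally show ?thesis using V(2) by simp
  qed
  have xV: "x i j \<in> V" if "i < m" "j \<le> d" for i j
    unfolding x_def by (rule sorted_list_of_set_nth_mem[OF V(1) idx[OF that]])
  have x1: "x i j < x i' j'" if "i < m" "i' < m" "j < j'" "j' \<le> d" for i i' j j'
  proof -
    have "j * m + rank_below m (s j) i < Suc j * m" using rank_below_less[OF that(1)] by simp
    also have "\<dots> \<le> j' * m" using that(3) by (intro mult_le_mono1) simp
    finally show ?thesis
      unfolding x_def using that by (intro sorted_list_of_set_nth_mono V(1) idx) auto
  qed
  have x2: "x i j < x i' j" if "i < m" "i' < m" "j \<le> d" "s j i < s j i'" for i i' j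
    unfolding x_def using that
    by (intro sorted_list_of_set_nth_mono V(1) idx add_strict_left_mono rank_below_mono) auto
  show ?thesis
  proof (rule occursI[where e = "\<lambda>i. x i ` {..d}", OF _ _ _ x1 x2])
    show "inj_on (\<lambda>i. x i ` {..d}) {..<m}"
    proof (rule inj_onI)
      fix i i' assume i: "i \<in> {..<m}" "i' \<in> {..<m}" "x i ` {..d} = x i' ` {..d}"
      have "x i 0 \<in> x i ` {..d}" "x i' 0 \<in> x i' ` {..d}" by auto
      then obtain j j' where j: "j \<le> d" "x i 0 = x i' j" "j' \<le> d" "x i' 0 = x i j'"
        using i(3) by (metis (no_types, lifting) atMost_iff imageE)
      have "j = 0" using x1[of i i' 0 j] i j by (cases "j = 0") auto
      then have "\<not> s 0 i < s 0 i'" "\<not> s 0 i' < s 0 i"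
        using j i x2[of i i' 0] x2[of i' i 0] by auto
      then show "i = i'" using s i by (auto simp: inj_on_def)
    qed
    show "x i ` {..d} \<in> G" if i: "i < m" for i
    proof (rule G)
      show "x i ` {..d} \<subseteq> V" using xV[OF i] by auto
      have "inj_on (x i) {..d}" by (rule linorder_inj_onI') (use x1[OF i i] in \<open>auto simp: neq_iff\<close>)
      then show "card (x i ` {..d}) = Suc d" by (simp add: card_image)
    qed
  qed auto
qed

text \<open>The sets of the family need not be distinct. Distinct \<open>(d + 1)\<close>-subsets are chosen greedily: if all
  of them are taken in some set, then they contain the pattern.\<close>

lemma family_card_le:
  assumes s: "inj_on (s 0) {..<m}"
  shows "\<exists>C. \<forall>k\<ge>1. \<forall>(\<Omega> :: 'w set) K. finite \<Omega> \<longrightarrow>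
    (\<forall>w\<in>\<Omega>. K w \<subseteq> {..<k} \<and> Suc d * m \<le> card (K w)) \<longrightarrow> \<not> occurs d m s \<Omega> K \<longrightarrow> card \<Omega> \<le> C * k ^ d"
proof -
  obtain C where C: "\<forall>k\<ge>1. \<forall>H. H \<subseteq> {E \<in> Pow {..<k}. card E = Suc d} \<longrightarrow>
    \<not> occurs d m s H (\<lambda>E. E) \<longrightarrow> card H \<le> C * k ^ d"
    using uniform_card_le[where q = "Suc d" and d = d and s = s and m = m] s by blast
  have "card \<Omega> \<le> C * k ^ d"
    if k: "k \<ge> 1" and fin: "finite \<Omega>" and K: "\<forall>w\<in>\<Omega>. K w \<subseteq> {..<k} \<and> Suc d * m \<le> card (K w)"
      and av: "\<not> occurs d m s \<Omega> K" for k K and \<Omega> :: "'w set"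
  proof -
    have avG: "\<not> occurs d m s (g ` F) (\<lambda>E. E)"
      if "F \<subseteq> \<Omega>" "inj_on g F" "\<forall>w\<in>F. g w \<subseteq> K w" for g F
    proof
      assume "occurs d m s (g ` F) (\<lambda>E. E)"
      then have "occurs d m s \<Omega> K"
      proof (rule occurs_lift[where h = "inv_into F g" and \<phi> = id])
        show "inj_on (inv_into F g) (g ` F)" by (rule inj_on_inv_into) simp
        fix E assume E: "E \<in> g ` F"
        then have "inv_into F g E \<in> F" "g (inv_into F g E) = E" by (rule inv_into_into, rule f_inv_into_f)
        then show "inv_into F g E \<in> \<Omega>" "E \<subseteq> id ` K (inv_into F g E)" using that by auto
      qed (simp add: mono_def)
      then show False using av by contradiction
    qed
    have "\<exists>g. inj_on g F \<and> (\<forall>w\<in>F. g w \<subseteq> K w \<and> card (g w) = Suc d)" if "finite F" "F \<subseteq> \<Omega>" for F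
      using that
    proof (induction F rule: finite_induct)
      case empty show ?case by simp
    next
      case (insert w F)
      then obtain g where g: "inj_on g F" "\<forall>w\<in>F. g w \<subseteq> K w \<and> card (g w) = Suc d" by blast
      have "\<exists>E. E \<subseteq> K w \<and> card E = Suc d \<and> E \<notin> g ` F"
      proof (rule ccontr)
        assume no: "\<not> ?thesis"
        have "occurs d m s (g ` F) (\<lambda>E. E)"
        proof (rule occurs_clique[where s = s and V = "K w"])
          show "inj_on (s 0) {..<m}" by (rule s)
          show "finite (K w)" "Suc d * m \<le> card (K w)" using K insert.prems by (auto intro: finite_subset)
        qed (use no in blast)
        then show False using avG[of F g] g insert.prems by auto
      qed
      then obtain E where E: "E \<subseteq> K w" "card E = Suc d" "E \<notin> g ` F" by blast
      have "inj_on (g(w := E)) (insert w F)" using g(1) E(3) insert.hyps(2) by (auto simp: inj_on_def)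
      moreover have "\<forall>v\<in>insert w F. (g(w := E)) v \<subseteq> K v \<and> card ((g(w := E)) v) = Suc d"
        using g(2) E by auto
      ultimately show ?case by blast
    qed
    from this[OF fin] obtain g where g: "inj_on g \<Omega>" "\<forall>w\<in>\<Omega>. g w \<subseteq> K w \<and> card (g w) = Suc d" by blast
    have "g ` \<Omega> \<subseteq> {E \<in> Pow {..<k}. card E = Suc d}" using g(2) K by auto
    then have "card (g ` \<Omega>) \<le> C * k ^ d" using C k avG[of \<Omega> g] g by blast
    then show ?thesis using card_image[OF g(1)] by simp
  qed
  then show ?thesis by (intro exI[of _ C]) blast
qed

section \<open>Counting hypergraphs that avoid a pattern\<close>

lemma occurs_mono: "occurs d m s G K \<Longrightarrow> G \<subseteq> \<Omega> \<Longrightarrow> occurs d m s \<Omega> K"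
  by (erule occurs_lift[where h = "\<lambda>g. g" and \<phi> = "\<lambda>x. x"]) (auto simp: mono_def)

text \<open>A large edge is chopped into consecutive chunks. Two chunks of the same edge are never used in
  one occurrence, since the elements of one chunk precede those of the other.\<close>

lemma weight_large_le:
  assumes s: "inj_on (s 0) {..<m}" and d: "d \<ge> 1"
  shows "\<exists>C. \<forall>k\<ge>1. \<forall>H\<subseteq>Pow {..<k}. \<not> occurs d m s H (\<lambda>E. E) \<longrightarrow>
    (\<Sum>E | E \<in> H \<and> Suc d * Suc m \<le> card E. card E) \<le> C * k ^ d"
proof -
  \<comment> \<open>Large enough for the threshold \<open>Suc d * m\<close> of
    \<open>family_card_le\<close>, and positive even for \<open>m = 0\<close>.\<close>
  define Q where "Q = Suc d * Suc m"
  obtain C where C: "\<forall>k\<ge>1. \<forall>(\<Omega> :: (nat set \<times> nat) set) K. finite \<Omega> \<longrightarrow>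
    (\<forall>w\<in>\<Omega>. K w \<subseteq> {..<k} \<and> Suc d * m \<le> card (K w)) \<longrightarrow> \<not> occurs d m s \<Omega> K \<longrightarrow> card \<Omega> \<le> C * k ^ d"
    using family_card_le[where 'w = "nat set \<times> nat" and d = d and s = s and m = m] s by blast
  have "(\<Sum>E | E \<in> H \<and> Q \<le> card E. card E) \<le> 2 * Q * C * k ^ d"
    if k: "k \<ge> 1" and H: "H \<subseteq> Pow {..<k}" and av: "\<not> occurs d m s H (\<lambda>E. E)" for k H
  proof -
    define L where "L = {E. E \<in> H \<and> Q \<le> card E}"
    have finH: "finite H" using H by (rule finite_subset) simp
    have finE: "finite E" if "E \<in> H" for E using that H by (auto intro: finite_subset)
    define \<Omega> where "\<Omega> = Sigma L (\<lambda>E. {..<card E div Q})"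
    define K where "K w = (!) (sorted_list_of_set (fst w)) ` {snd w * Q..<Suc (snd w) * Q}" for w :: "nat set \<times> nat"
    have bound: "Suc c * Q \<le> card E" if "(E, c) \<in> \<Omega>" for E c
    proof -
      have "Suc c \<le> card E div Q" using that by (auto simp: \<Omega>_def)
      then have "Suc c * Q \<le> card E div Q * Q" by (rule mult_le_mono1)
      then show ?thesis by (meson div_times_less_eq_dividend le_trans)
    qed
    have nth_less: "sorted_list_of_set E ! i < sorted_list_of_set E ! i'"
      if "(E, c) \<in> \<Omega>" "i < i'" "i' < Suc c * Q" for E c i i'
      using that bound[OF that(1)] finE[of E]
      by (intro sorted_list_of_set_nth_mono) (auto simp: \<Omega>_def L_def)
    have KE: "K (E, c) \<subseteq> E" if "(E, c) \<in> \<Omega>" for E c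
      unfolding K_def using that bound[OF that] finE[of E]
      by (auto simp: \<Omega>_def L_def intro!: sorted_list_of_set_nth_mem)
    have Kcard: "card (K (E, c)) = Q" if "(E, c) \<in> \<Omega>" for E c
    proof -
      have "inj_on ((!) (sorted_list_of_set E)) {c * Q..<Suc c * Q}"
        by (rule linorder_inj_onI') (use nth_less[OF that] in fastforce)
      then show ?thesis by (simp add: K_def card_image)
    qed
    have "\<not> occurs d m s \<Omega> K"
    proof
      assume "occurs d m s \<Omega> K"
      then have "occurs d m s H (\<lambda>E. E)"
      proof (rule occursE)
        fix e x
        assume e: "inj_on e {..<m}" "\<And>i. i < m \<Longrightarrow> e i \<in> \<Omega>"
          and x: "\<And>i j. i < m \<Longrightarrow> j \<le> d \<Longrightarrow> x i j \<in> K (e i)"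
            "\<And>i i' j j'. i < m \<Longrightarrow> i' < m \<Longrightarrow> j < j' \<Longrightarrow> j' \<le> d \<Longrightarrow> x i j < x i' j'"
            "\<And>i i' j. i < m \<Longrightarrow> i' < m \<Longrightarrow> j \<le> d \<Longrightarrow> s j i < s j i' \<Longrightarrow> x i j < x i' j"
        \<comment> \<open>Two rows are essential here: if \<open>i\<close> used an earlier chunk
          than \<open>i'\<close>, its point in row 1 would precede the point of \<open>i'\<close> in
          row 0, against the order of the rows.\<close>
        have no: "\<not> snd (e i) < snd (e i')" if i: "i < m" "i' < m" "fst (e i) = fst (e i')" for i i'
        proof
          assume lt: "snd (e i) < snd (e i')"
          have e': "(fst (e i), snd (e i')) \<in> \<Omega>" using e(2)[OF i(2)] i(3) by simp
          obtain a where a: "a < Suc (snd (e i)) * Q" "x i 1 = sorted_list_of_set (fst (e i)) ! a"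
            using x(1)[OF i(1) d] by (auto simp: K_def)
          obtain b where b: "snd (e i') * Q \<le> b" "b < Suc (snd (e i')) * Q"
            "x i' 0 = sorted_list_of_set (fst (e i)) ! b"
            using x(1)[OF i(2), of 0] i(3) by (auto simp: K_def)
          have "Suc (snd (e i)) * Q \<le> snd (e i') * Q" using lt by (intro mult_le_mono1) simp
          then have "a < b" using a b by linarith
          then have "x i 1 < x i' 0" using nth_less[OF e' _ b(2)] a b by simp
          moreover have "x i' 0 < x i 1" using x(2)[OF i(2) i(1), of 0 1] d by simp
          ultimately show False by simp
        qed
        show ?thesis
        proof (rule occursI[where e = "fst \<circ> e" and x = x, OF _ _ _ x(2,3)])
          show "inj_on (fst \<circ> e) {..<m}"
          proof (rule inj_onI)
            fix i i' assume i: "i \<in> {..<m}" "i' \<in> {..<m}" "(fst \<circ> e) i = (fst \<circ> e) i'"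
            then have "snd (e i) = snd (e i')" using no[of i i'] no[of i' i] by simp
            then have "e i = e i'" using i(3) by (simp add: prod_eq_iff)
            then show "i = i'" using inj_onD[OF e(1)] i by blast
          qed
          show "(fst \<circ> e) i \<in> H" if "i < m" for i using e(2)[OF that] by (auto simp: \<Omega>_def L_def)
          show "x i j \<in> (fst \<circ> e) i" if "i < m" "j \<le> d" for i j
            using x(1)[OF that] KE[of "fst (e i)" "snd (e i)"] e(2)[OF that(1)] by auto
        qed
      qed
      then show False using av by contradiction
    qed
    moreover have "finite \<Omega>" using finH by (simp add: \<Omega>_def L_def)
    moreover have "K w \<subseteq> {..<k} \<and> Suc d * m \<le> card (K w)" if "w \<in> \<Omega>" for w
    proof -
      have "K w \<subseteq> fst w" "card (K w) = Q" "fst w \<in> H"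
        using KE[of "fst w" "snd w"] Kcard[of "fst w" "snd w"] that by (auto simp: \<Omega>_def L_def)
      then show ?thesis using H by (auto simp: Q_def)
    qed
    ultimately have "card \<Omega> \<le> C * k ^ d" using C k by blast
    \<comment> \<open>As \<open>card E \<ge> Q\<close>, the remainder modulo \<open>Q\<close> makes
      up less than half of \<open>E\<close>.\<close>
    have "(\<Sum>E\<in>L. card E) \<le> (\<Sum>E\<in>L. 2 * Q * (card E div Q))"
    proof (rule sum_mono)
      fix E assume "E \<in> L"
      then have "Q \<le> card E" by (simp add: L_def)
      moreover have Q: "Q > 0" by (simp add: Q_def)
      ultimately have "1 \<le> card E div Q" by (simp add: Suc_le_eq div_greater_zero_iff)
      then have "Q * 1 \<le> Q * (card E div Q)" by (rule mult_le_mono2)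
      moreover have "card E < Q + Q * (card E div Q)" using Q by (rule dividend_less_times_div)
      ultimately have "card E \<le> Q * (card E div Q) + Q * (card E div Q)" by linarith
      then show "card E \<le> 2 * Q * (card E div Q)" by simp
    qed
    also have "\<dots> = 2 * Q * card \<Omega>"
      unfolding \<Omega>_def using finH by (subst card_SigmaI) (auto simp: L_def sum_distrib_left)
    also have "\<dots> \<le> 2 * Q * (C * k ^ d)" using \<open>card \<Omega> \<le> C * k ^ d\<close> by (rule mult_le_mono2)
    finally show ?thesis by (simp add: L_def mult.assoc)
  qed
  then show ?thesis unfolding Q_def by blast
qed

text \<open>The constant of \<open>uniform_card_le\<close> depends on the edge size without control,
  so it is used only for the finitely many sizes below \<open>Q\<close>. All larger edges are
  handled together by \<open>weight_large_le\<close>.\<close>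

lemma weight_le:
  assumes s: "inj_on (s 0) {..<m}" and d: "d \<ge> 1"
  shows "\<exists>C. \<forall>k\<ge>1. \<forall>H\<subseteq>Pow {..<k}. \<not> occurs d m s H (\<lambda>E. E) \<longrightarrow> (\<Sum>E\<in>H. card E) \<le> C * k ^ d"
proof -
  define Q where "Q = Suc d * Suc m"
  obtain C where C: "\<forall>k\<ge>1. \<forall>H\<subseteq>Pow {..<k}. \<not> occurs d m s H (\<lambda>E. E) \<longrightarrow>
    (\<Sum>E | E \<in> H \<and> Q \<le> card E. card E) \<le> C * k ^ d"
    using weight_large_le[where d = d and s = s and m = m] s d unfolding Q_def by blast
  have "\<forall>q. \<exists>C. \<forall>k\<ge>1. \<forall>H. H \<subseteq> {E \<in> Pow {..<k}. card E = q} \<longrightarrow> \<not> occurs d m s H (\<lambda>E. E)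
    \<longrightarrow> card H \<le> C * k ^ d"
    using uniform_card_le[where d = d and s = s and m = m] s by blast
  from choice[OF this] obtain c where c: "\<forall>q. \<forall>k\<ge>1. \<forall>H. H \<subseteq> {E \<in> Pow {..<k}. card E = q} \<longrightarrow>
    \<not> occurs d m s H (\<lambda>E. E) \<longrightarrow> card H \<le> c q * k ^ d" ..
  have "(\<Sum>E\<in>H. card E) \<le> ((\<Sum>q<Q. c q * q) + C) * k ^ d"
    if k: "k \<ge> 1" and H: "H \<subseteq> Pow {..<k}" and av: "\<not> occurs d m s H (\<lambda>E. E)" for k H
  proof -
    have finH: "finite H" using H by (rule finite_subset) simp
    have "(\<Sum>E\<in>H. card E) = (\<Sum>E | E \<in> H \<and> card E < Q. card E) + (\<Sum>E | E \<in> H \<and> Q \<le> card E. card E)"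
      using finH by (subst sum.union_disjoint[symmetric]) (auto intro!: sum.cong)
    also have "(\<Sum>E | E \<in> H \<and> card E < Q. card E) = (\<Sum>q<Q. \<Sum>E | E \<in> H \<and> card E = q. card E)"
      using finH by (subst sum.UNION_disjoint[symmetric]) (auto intro!: sum.cong)
    also have "\<dots> \<le> (\<Sum>q<Q. c q * q * k ^ d)"
    proof (rule sum_mono)
      fix q
      have "{E. E \<in> H \<and> card E = q} \<subseteq> {E \<in> Pow {..<k}. card E = q}" using H by blast
      moreover have "\<not> occurs d m s {E. E \<in> H \<and> card E = q} (\<lambda>E. E)"
        using av occurs_mono[of d m s "{E. E \<in> H \<and> card E = q}" "\<lambda>E. E" H] by blast
      ultimately have le: "card {E. E \<in> H \<and> card E = q} \<le> c q * k ^ d" using c k by blast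
      have "(\<Sum>E | E \<in> H \<and> card E = q. card E) = q * card {E. E \<in> H \<and> card E = q}" by simp
      also have "\<dots> \<le> q * (c q * k ^ d)" using le by (rule mult_le_mono2)
      finally show "(\<Sum>E | E \<in> H \<and> card E = q. card E) \<le> c q * q * k ^ d" by (simp add: algebra_simps)
    qed
    also have "(\<Sum>E | E \<in> H \<and> Q \<le> card E. card E) \<le> C * k ^ d" using C k H av by blast
    finally show ?thesis by (simp only: distrib_right sum_distrib_right)
  qed
  then show ?thesis by blast
qed

text \<open>A family of weight \<open>w\<close> is counted with the factor \<open>4 ^ (W - w) \<ge> 1\<close>.\<close>

lemma card_bounded_weight_le:
  fixes w :: "'a \<Rightarrow> nat"
  assumes "finite U"
  shows "real (card {H. H \<subseteq> U \<and> (\<Sum>E\<in>H. w E) \<le> W}) \<le> 4 ^ W * exp (\<Sum>E\<in>U. (1/4) ^ w E)"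
proof -
  let ?F = "{H. H \<subseteq> U \<and> (\<Sum>E\<in>H. w E) \<le> W}"
  have "real (card ?F) = (\<Sum>H\<in>?F. 1)" by simp
  also have "\<dots> \<le> (\<Sum>H\<in>?F. 4 ^ W * (\<Prod>E\<in>H. (1/4) ^ w E))"
  proof (rule sum_mono)
    fix H assume "H \<in> ?F"
    then have "(4::real) ^ (\<Sum>E\<in>H. w E) \<le> 4 ^ W" by (intro power_increasing) auto
    then have "(1::real) \<le> 4 ^ W * (1/4) ^ (\<Sum>E\<in>H. w E)" by (simp add: power_one_over)
    then show "(1::real) \<le> 4 ^ W * (\<Prod>E\<in>H. (1/4) ^ w E)" by (simp add: power_sum)
  qed
  also have "\<dots> \<le> (\<Sum>H\<in>Pow U. 4 ^ W * (\<Prod>E\<in>H. (1/4) ^ w E))"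
    using assms by (intro sum_mono2) (auto intro!: mult_nonneg_nonneg prod_nonneg)
  also have "\<dots> = 4 ^ W * (\<Prod>E\<in>U. (1/4) ^ w E + 1)"
    using prod_add[OF assms, of "\<lambda>E. (1/4) ^ w E" "\<lambda>_. 1::real"] by (simp add: sum_distrib_left)
  also have "(\<Prod>E\<in>U. (1/4::real) ^ w E + 1) \<le> (\<Prod>E\<in>U. exp ((1/4) ^ w E))"
    by (intro prod_mono) (simp add: add.commute)
  also have "\<dots> = exp (\<Sum>E\<in>U. (1/4) ^ w E)" using assms by (rule exp_sum[symmetric])
  finally show ?thesis by simp
qed

definition avoiders :: "nat \<Rightarrow> nat \<Rightarrow> (nat \<Rightarrow> nat \<Rightarrow> nat) \<Rightarrow> nat \<Rightarrow> nat set set set" where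
  "avoiders d m s k = {H. H \<subseteq> Pow {..<k} \<and> \<not> occurs d m s H (\<lambda>E. E)}"

lemma finite_avoiders: "finite (avoiders d m s k)"
  by (rule finite_subset[of _ "Pow (Pow {..<k})"]) (auto simp: avoiders_def)

abbreviation halve :: "nat set \<Rightarrow> nat set" where "halve E \<equiv> (\<lambda>x. x div 2) ` E"

lemma halve_avoiders:
  assumes "H \<in> avoiders d m s (2 * k)"
  shows "halve ` H \<in> avoiders d m s k"
proof -
  have "\<not> occurs d m s (halve ` H) (\<lambda>E. E)"
  proof
    assume "occurs d m s (halve ` H) (\<lambda>E. E)"
    then have "occurs d m s H (\<lambda>E. E)"
    proof (rule occurs_lift[where h = "inv_into H halve" and \<phi> = "\<lambda>x. x div 2"])
      show "inj_on (inv_into H halve) (halve ` H)" by (rule inj_on_inv_into) simp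
      show "mono (\<lambda>x::nat. x div 2)" by (simp add: mono_def div_le_mono)
      fix E assume E: "E \<in> halve ` H"
      show "inv_into H halve E \<in> H" using E by (rule inv_into_into)
      show "E \<subseteq> halve (inv_into H halve E)" using f_inv_into_f[OF E] by simp
    qed
    then show False using assms by (simp add: avoiders_def)
  qed
  moreover have "halve ` H \<subseteq> Pow {..<k}" using assms by (fastforce simp: avoiders_def)
  ultimately show ?thesis by (simp add: avoiders_def)
qed

lemma halve_preimage_subset:
  "{F. halve F = E} \<subseteq> Pow ((\<lambda>x. 2 * x) ` E \<union> (\<lambda>x. 2 * x + 1) ` E)"
proof (intro subsetI PowI)
  fix F y assume "F \<in> {F. halve F = E}" "y \<in> F"
  then have "y div 2 \<in> E" by auto
  moreover have "y = 2 * (y div 2) \<or> y = 2 * (y div 2) + 1" by presburger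
  ultimately show "y \<in> (\<lambda>x. 2 * x) ` E \<union> (\<lambda>x. 2 * x + 1) ` E" by blast
qed

text \<open>Each vertex has two preimages, so the preimages of \<open>E\<close> are subsets of a set
  of size at most \<open>2 * card E\<close>. This is the 4 that the weights
  \<open>(1/4) ^ card E\<close> cancel.\<close>

lemma card_halve_preimage_le:
  assumes "finite E"
  shows "finite {F. halve F = E}" "card {F. halve F = E} \<le> 4 ^ card E"
proof -
  have fin: "finite ((\<lambda>x. 2 * x) ` E \<union> (\<lambda>x. 2 * x + 1) ` E)" using assms by simp
  have "card {F. halve F = E} \<le> 2 ^ card ((\<lambda>x. 2 * x) ` E \<union> (\<lambda>x. 2 * x + 1) ` E)"
    using card_mono[OF _ halve_preimage_subset] fin by (simp add: card_Pow)
  also have "\<dots> \<le> 2 ^ (2 * card E)"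
  proof (rule power_increasing)
    have "card ((\<lambda>x. 2 * x) ` E \<union> (\<lambda>x. 2 * x + 1) ` E) \<le> card ((\<lambda>x. 2 * x) ` E) + card ((\<lambda>x. 2 * x + 1) ` E)"
      by (rule card_Un_le)
    also have "\<dots> \<le> card E + card E" by (intro add_mono card_image_le assms)
    finally show "card ((\<lambda>x. 2 * x) ` E \<union> (\<lambda>x. 2 * x + 1) ` E) \<le> 2 * card E" by simp
  qed simp
  finally show "card {F. halve F = E} \<le> 4 ^ card E" by (simp add: power_mult)
  show "finite {F. halve F = E}" using fin by (intro finite_subset[OF halve_preimage_subset]) simp
qed

text \<open>The summand 1 accounts for the empty edge, which has no weight.\<close>

lemma card_le_weight: "finite H \<Longrightarrow> (\<And>E. E \<in> H \<Longrightarrow> finite E) \<Longrightarrow> card H \<le> (\<Sum>E\<in>H. card E) + 1"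
proof -
  assume H: "finite H" "\<And>E. E \<in> H \<Longrightarrow> finite E"
  have "card (H - {{}}) = (\<Sum>E\<in>H - {{}}. 1)" by simp
  also have "\<dots> \<le> (\<Sum>E\<in>H - {{}}. card E)"
    using H(2) by (intro sum_mono) (auto simp: Suc_le_eq card_gt_0_iff)
  also have "\<dots> \<le> (\<Sum>E\<in>H. card E)" using H(1) by (intro sum_mono2) auto
  finally have "card (H - {{}}) \<le> (\<Sum>E\<in>H. card E)" .
  moreover have "card H \<le> card (insert {} (H - {{}}))" using H(1) by (intro card_mono) auto
  moreover have "card (insert {} (H - {{}})) = card (H - {{}}) + 1" using H(1) by (subst card_insert_disjoint) auto
  ultimately show ?thesis by linarith
qed

text \<open>Edges are weighed by the size of their halves, so all preimages of \<open>E'\<close> get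
  the same weight \<open>(1/4) ^ card E'\<close>. Since there are at most \<open>4 ^ card E'\<close>
  of them, each edge of \<open>H'\<close> adds at most 1 to the exponent in
  \<open>card_bounded_weight_le\<close>, and all edges together at most \<open>V\<close>.\<close>

lemma card_avoiders_double_le:
  assumes W: "\<And>H. H \<in> avoiders d m s (2 * k) \<Longrightarrow> (\<Sum>E\<in>H. card E) \<le> W"
    and V: "\<And>H. H \<in> avoiders d m s k \<Longrightarrow> card H \<le> V"
  shows "real (card (avoiders d m s (2 * k))) \<le> card (avoiders d m s k) * (4 ^ W * exp (real V))"
proof -
  let ?A = "avoiders d m s (2 * k)" and ?B = "avoiders d m s k"
  have fib: "real (card {H \<in> ?A. halve ` H = H'}) \<le> 4 ^ W * exp (real V)" if H': "H' \<in> ?B" for H'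
  proof -
    define U where "U = {E. E \<subseteq> {..<2 * k} \<and> halve E \<in> H'}"
    have finU: "finite U" by (rule finite_subset[of _ "Pow {..<2 * k}"]) (auto simp: U_def)
    have finH': "finite H'" using H' by (auto simp: avoiders_def intro: finite_subset)
    have finE: "finite E" if "E \<in> H'" for E
      using that H' by (auto simp: avoiders_def intro: finite_subset[of _ "{..<k}"])
    have "{H \<in> ?A. halve ` H = H'} \<subseteq> {H. H \<subseteq> U \<and> (\<Sum>E\<in>H. card (halve E)) \<le> W}"
    proof
      fix H assume "H \<in> {H \<in> ?A. halve ` H = H'}"
      then have H: "H \<in> ?A" "halve ` H = H'" by auto
      have sub: "E \<subseteq> {..<2 * k}" if "E \<in> H" for E using H(1) that by (auto simp: avoiders_def)
      then have "(\<Sum>E\<in>H. card (halve E)) \<le> (\<Sum>E\<in>H. card E)"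
        by (intro sum_mono card_image_le) (auto intro: finite_subset)
      also have "\<dots> \<le> W" by (rule W[OF H(1)])
      finally show "H \<in> {H. H \<subseteq> U \<and> (\<Sum>E\<in>H. card (halve E)) \<le> W}"
        using H(2) sub by (auto simp: U_def)
    qed
    moreover have "finite {H. H \<subseteq> U \<and> (\<Sum>E\<in>H. card (halve E)) \<le> W}"
      by (rule finite_subset[of _ "Pow U"]) (use finU in auto)
    ultimately have "card {H \<in> ?A. halve ` H = H'} \<le>
        card {H. H \<subseteq> U \<and> (\<Sum>E\<in>H. card (halve E)) \<le> W}" by (rule card_mono[rotated])
    then have "real (card {H \<in> ?A. halve ` H = H'}) \<le>
        real (card {H. H \<subseteq> U \<and> (\<Sum>E\<in>H. card (halve E)) \<le> W})" by (rule of_nat_mono)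
    also have "\<dots> \<le> 4 ^ W * exp (\<Sum>E\<in>U. (1/4) ^ card (halve E))"
      by (rule card_bounded_weight_le[OF finU])
    also have "(\<Sum>E\<in>U. (1/4) ^ card (halve E)) \<le> real V"
    proof -
      have "(\<Sum>E\<in>U. (1/4::real) ^ card (halve E)) = (\<Sum>E'\<in>H'. \<Sum>E | E \<in> U \<and> halve E = E'. (1/4) ^ card (halve E))"
        by (rule sum.group[symmetric]) (use finU finH' in \<open>auto simp: U_def\<close>)
      also have "\<dots> \<le> (\<Sum>E'\<in>H'. 1)"
      proof (rule sum_mono)
        fix E' assume E': "E' \<in> H'"
        have "(\<Sum>E | E \<in> U \<and> halve E = E'. (1/4::real) ^ card (halve E)) =
            real (card {E. E \<in> U \<and> halve E = E'}) * (1/4) ^ card E'" by simp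
        also have "\<dots> \<le> real (4 ^ card E') * (1/4) ^ card E'"
        proof (intro mult_right_mono of_nat_mono)
          have "card {E. E \<in> U \<and> halve E = E'} \<le> card {F. halve F = E'}"
            using card_halve_preimage_le(1)[OF finE[OF E']] by (rule card_mono) auto
          then show "card {E. E \<in> U \<and> halve E = E'} \<le> 4 ^ card E'"
            using card_halve_preimage_le(2)[OF finE[OF E']] by (rule le_trans)
        qed simp
        also have "\<dots> = 1" by (simp add: power_one_over)
        finally show "(\<Sum>E | E \<in> U \<and> halve E = E'. (1/4::real) ^ card (halve E)) \<le> 1" .
      qed
      also have "\<dots> \<le> real V" using V[OF H'] by simp
      finally show ?thesis .
    qed
    finally show ?thesis by simp
  qed
  have "card ?A = (\<Sum>H'\<in>?B. card {H \<in> ?A. halve ` H = H'})"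
    using sum.group[OF finite_avoiders finite_avoiders, of "(`) halve" d m s "2 * k" d m s k "\<lambda>_. 1::nat"]
      halve_avoiders by fastforce
  then have "real (card ?A) = (\<Sum>H'\<in>?B. real (card {H \<in> ?A. halve ` H = H'}))" by simp
  also have "\<dots> \<le> (\<Sum>H'\<in>?B. 4 ^ W * exp (real V))" by (rule sum_mono) (rule fib)
  finally show ?thesis by simp
qed

lemma card_avoider_le:
  assumes s: "inj_on (s 0) {..<m}" and d: "d \<ge> 1"
  shows "\<exists>C. \<forall>k\<ge>1. \<forall>H\<in>avoiders d m s k. card H \<le> C * k ^ d"
proof -
  obtain C where C: "\<forall>k\<ge>1. \<forall>H\<subseteq>Pow {..<k}. \<not> occurs d m s H (\<lambda>E. E) \<longrightarrow> (\<Sum>E\<in>H. card E) \<le> C * k ^ d"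
    using weight_le[where d = d and s = s and m = m] s d by blast
  have "card H \<le> (C + 1) * k ^ d" if "k \<ge> 1" "H \<in> avoiders d m s k" for k H
  proof -
    have "card H \<le> (\<Sum>E\<in>H. card E) + 1"
      using that(2) by (intro card_le_weight) (auto simp: avoiders_def intro: finite_subset)
    moreover have "1 \<le> k ^ d" using that(1) by simp
    moreover have "(\<Sum>E\<in>H. card E) \<le> C * k ^ d" using C that by (auto simp: avoiders_def)
    ultimately show ?thesis by (simp add: distrib_right)
  qed
  then show ?thesis by blast
qed

text \<open>A doubling costs a factor \<open>D ^ N\<close> with \<open>N = k ^ d\<close>, and it
  multiplies \<open>N\<close> by \<open>2 ^ d \<ge> 2\<close>. The exponents thus grow geometrically
  and their sum is of the order of the last one.\<close>

lemma card_avoiders_le: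
  assumes s: "inj_on (s 0) {..<m}" and d: "d \<ge> 1"
  shows "\<exists>c\<ge>1. \<forall>e. real (card (avoiders d m s (2 ^ e))) \<le> c ^ ((2 ^ e) ^ d)"
proof -
  obtain C where C: "\<forall>k\<ge>1. \<forall>H\<subseteq>Pow {..<k}. \<not> occurs d m s H (\<lambda>E. E) \<longrightarrow> (\<Sum>E\<in>H. card E) \<le> C * k ^ d"
    using weight_le[where d = d and s = s and m = m] s d by blast
  have wt: "(\<Sum>E\<in>H. card E) \<le> C * k ^ d" if "k \<ge> 1" "H \<in> avoiders d m s k" for k H
    using C that by (auto simp: avoiders_def)
  obtain C' where C': "\<forall>k\<ge>1. \<forall>H\<in>avoiders d m s k. card H \<le> C' * k ^ d"
    using card_avoider_le[where d = d and s = s and m = m] s d by blast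
  define D :: real where "D = 4 ^ (C * 2 ^ d) * exp (real C')"
  have D: "D \<ge> 1" unfolding D_def by (intro mult_ge1_I) auto
  \<comment> \<open>The 4 in the base counts all hypergraphs on one vertex, where the recursion
    starts.\<close>
  have "real (card (avoiders d m s (2 ^ e))) \<le> (4 * D) ^ ((2 ^ e) ^ d)" for e
  proof (induction e)
    case 0
    have "card (avoiders d m s 1) \<le> card (Pow (Pow {..<1::nat}))"
      by (rule card_mono) (auto simp: avoiders_def)
    then show ?case using D by (simp add: card_Pow)
  next
    case (Suc e)
    define N where "N = ((2::nat) ^ e) ^ d"
    have N2: "(2 * 2 ^ e) ^ d = 2 ^ d * N" by (simp add: N_def power_mult_distrib)
    have "real (card (avoiders d m s (2 * 2 ^ e))) \<le>
      card (avoiders d m s (2 ^ e)) * (4 ^ (C * (2 ^ d * N)) * exp (real (C' * N)))"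
    proof (rule card_avoiders_double_le)
      show "(\<Sum>E\<in>H. card E) \<le> C * (2 ^ d * N)" if "H \<in> avoiders d m s (2 * 2 ^ e)" for H
        using wt[OF _ that] N2 by simp
      show "card H \<le> C' * N" if "H \<in> avoiders d m s (2 ^ e)" for H
        using C' that by (simp add: N_def)
    qed
    also have "4 ^ (C * (2 ^ d * N)) * exp (real (C' * N)) = D ^ N"
    proof -
      have "(4::real) ^ (C * (2 ^ d * N)) = (4 ^ (C * 2 ^ d)) ^ N" by (simp add: power_mult mult.assoc)
      moreover have "exp (real (C' * N)) = exp (real C') ^ N"
        by (metis exp_of_nat2_mult mult.commute of_nat_mult)
      ultimately show ?thesis by (simp only: D_def power_mult_distrib)
    qed
    also have "real (card (avoiders d m s (2 ^ e))) * D ^ N \<le> (4 * D) ^ N * (4 * D) ^ N"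
      using Suc.IH D by (intro mult_mono power_mono) (auto simp: N_def)
    also have "\<dots> = (4 * D) ^ (2 * N)" by (simp add: mult_2 power_add)
    also have "\<dots> \<le> (4 * D) ^ (2 ^ d * N)"
    proof (rule power_increasing)
      have "2 ^ 1 \<le> (2::nat) ^ d" using d by (intro power_increasing) auto
      then show "2 * N \<le> 2 ^ d * N" by simp
    qed (use D in simp)
    finally show ?case using N2 by simp
  qed
  then show ?thesis using D by (intro exI[of _ "4 * D"]) auto
qed

section \<open>Counting partitions by their traces\<close>

text \<open>Pascal's recursion: a multiset either does not contain \<open>a\<close> or loses one
  copy of it, and both cases lower \<open>n + card H\<close> by one.\<close>

lemma multisets_bounded_size:
  assumes "finite H"
  shows "finite {M. set_mset M \<subseteq> H \<and> size M \<le> n} \<and> card {M. set_mset M \<subseteq> H \<and> size M \<le> n} \<le> 2 ^ (n + card H)"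
  using assms
proof (induction H arbitrary: n rule: finite_induct)
  case empty
  have "{M :: 'a multiset. set_mset M \<subseteq> {} \<and> size M \<le> n} = {{#}}" by auto
  then show ?case by simp
next
  case (insert a H)
  show ?case
  proof (induction n)
    case 0
    have "{M. set_mset M \<subseteq> insert a H \<and> size M \<le> 0} = {{#}}" by auto
    then show ?case by simp
  next
    case (Suc n)
    let ?T = "\<lambda>H n. {M. set_mset M \<subseteq> H \<and> size M \<le> n}"
    have sub: "?T (insert a H) (Suc n) \<subseteq> ?T H (Suc n) \<union> add_mset a ` ?T (insert a H) n"
    proof
      fix M assume M: "M \<in> ?T (insert a H) (Suc n)"
      show "M \<in> ?T H (Suc n) \<union> add_mset a ` ?T (insert a H) n"
      proof (cases "a \<in># M")
        case True
        then obtain M' where "M = add_mset a M'" by (rule mset_add)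
        then show ?thesis using M by auto
      next
        case False then show ?thesis using M by auto
      qed
    qed
    have fin: "finite (?T H (Suc n) \<union> add_mset a ` ?T (insert a H) n)" using insert.IH Suc.IH by simp
    have "card (?T (insert a H) (Suc n)) \<le> card (?T H (Suc n)) + card (add_mset a ` ?T (insert a H) n)"
      using card_mono[OF fin sub] card_Un_le by (rule le_trans)
    also have "\<dots> \<le> 2 ^ (Suc n + card H) + 2 ^ (n + card (insert a H))"
      using insert.IH Suc.IH card_image_le[of "?T (insert a H) n" "add_mset a"]
      by (intro add_mono) (blast intro: le_trans)+
    also have "\<dots> = 2 ^ (Suc n + card (insert a H))" using insert.hyps by simp
    finally show ?case using finite_subset[OF sub fin] by blast
  qed
qed

text \<open>If the blocks are numbered so that their traces under \<open>v\<close> are the list \<open>xs\<close>, then the partition is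
  recovered from the block number of each point, for which few choices remain.\<close>

lemma partition_labelling:
  assumes \<rho>: "partition_on A \<rho>" and A: "finite A"
    and xs: "image_mset (\<lambda>B. v ` B) (mset_set \<rho>) = mset xs"
  shows "\<exists>f. f \<in> A \<rightarrow>\<^sub>E {..<length xs} \<and> \<rho> = (\<lambda>i. {x \<in> A. f x = i}) ` {..<length xs} \<and>
    (\<forall>i<length xs. v ` {x \<in> A. f x = i} = xs ! i)"
proof -
  have fin: "finite \<rho>" using finite_elements[OF A \<rho>] .
  obtain bs0 where bs0: "set bs0 = \<rho>" "distinct bs0" using finite_distinct_list[OF fin] by blast
  \<comment> \<open>Any listing of the blocks has \<open>xs\<close> as its traces up to a
    permutation; permuting the blocks aligns the two lists even when traces repeat.\<close>
  have "mset xs = mset (map ((`) v) bs0)" using xs bs0 by (metis mset_map mset_set_set)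
  then obtain p where p: "p permutes {..<length (map ((`) v) bs0)}" "permute_list p (map ((`) v) bs0) = xs"
    by (rule mset_eq_permutation)
  define bs where "bs = permute_list p bs0"
  have bs: "set bs = \<rho>" "distinct bs" "map ((`) v) bs = xs"
    using p bs0 by (simp_all add: bs_def permute_list_map)
  have len: "length xs = length bs" using bs(3) by auto
  have ex: "\<exists>i<length bs. x \<in> bs ! i" if "x \<in> A" for x
    using that bs(1) partition_onD1[OF \<rho>] by (metis UnionE in_set_conv_nth)
  have uniq: "i = j" if "i < length bs" "j < length bs" "x \<in> bs ! i" "x \<in> bs ! j" for i j x
  proof -
    have "bs ! i \<in> \<rho>" "bs ! j \<in> \<rho>" using that bs(1) nth_mem by blast+
    then have "bs ! i = bs ! j" using that(3,4) partition_onD2[OF \<rho>] by (auto dest: disjointD)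
    then show ?thesis using that(1,2) bs(2) nth_eq_iff_index_eq by blast
  qed
  define f where "f = (\<lambda>x\<in>A. SOME i. i < length bs \<and> x \<in> bs ! i)"
  have f: "f x < length bs \<and> x \<in> bs ! f x" if "x \<in> A" for x
    using someI_ex[OF ex[OF that]] that by (simp add: f_def)
  have fib: "{x \<in> A. f x = i} = bs ! i" if "i < length bs" for i
  proof (intro set_eqI iffI)
    fix x assume "x \<in> {x \<in> A. f x = i}" then show "x \<in> bs ! i" using f by auto
  next
    fix x assume x: "x \<in> bs ! i"
    then have "x \<in> A" using nth_mem[OF that] bs(1) partition_onD1[OF \<rho>] by blast
    then show "x \<in> {x \<in> A. f x = i}" using uniq[OF that _ x] f by blast
  qed
  show ?thesis
  proof (intro exI[of _ f] conjI allI impI)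
    show "f \<in> A \<rightarrow>\<^sub>E {..<length xs}" using f len by (auto simp: f_def)
    have "\<rho> = (\<lambda>i. bs ! i) ` {..<length bs}" using bs(1) by (auto simp: set_conv_nth)
    then show "\<rho> = (\<lambda>i. {x \<in> A. f x = i}) ` {..<length xs}" using fib len by auto
    show "v ` {x \<in> A. f x = i} = xs ! i" if "i < length xs" for i
      using that fib len bs(3) nth_map[of i bs "(`) v"] by simp
  qed
qed

text \<open>Once the traces are listed, a point can only join a block whose trace contains its cell.
  Each such block owns a point of that cell, so at most \<open>L\<close> labels are admissible for
  the point.\<close>

lemma card_partitions_trace_le:
  assumes A: "finite A" and L: "\<And>x. x \<in> A \<Longrightarrow> card {y \<in> A. v y = v x} \<le> L"
  shows "card {\<rho>. partition_on A \<rho> \<and> image_mset (\<lambda>B. v ` B) (mset_set \<rho>) = M} \<le> L ^ card A"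
    (is "card ?C \<le> _")
proof (cases "?C = {}")
  case False
  then obtain \<rho> where \<rho>: "\<rho> \<in> ?C" by blast
  obtain xs where xs: "mset xs = M" using ex_mset by blast
  let ?F = "PiE A (\<lambda>x. {i. i < length xs \<and> v x \<in> xs ! i})"
  have sub: "?C \<subseteq> (\<lambda>f. (\<lambda>i. {x \<in> A. f x = i}) ` {..<length xs}) ` ?F"
  proof
    fix \<rho> assume \<rho>: "\<rho> \<in> ?C"
    then obtain f where f: "f \<in> A \<rightarrow>\<^sub>E {..<length xs}" "\<rho> = (\<lambda>i. {x \<in> A. f x = i}) ` {..<length xs}"
      "\<forall>i<length xs. v ` {x \<in> A. f x = i} = xs ! i"
      using xs partition_labelling[OF _ A, of \<rho> v xs] by auto
    have "f \<in> ?F"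
    proof (rule PiE_I)
      fix x assume x: "x \<in> A"
      then have "f x < length xs" using f(1) by auto
      moreover from this have "v x \<in> xs ! f x" using f(3) x by blast
      ultimately show "f x \<in> {i. i < length xs \<and> v x \<in> xs ! i}" by simp
    qed (use f(1) in auto)
    then show "\<rho> \<in> (\<lambda>f. (\<lambda>i. {x \<in> A. f x = i}) ` {..<length xs}) ` ?F" using f(2) by blast
  qed
  \<comment> \<open>The admissible labels depend only on \<open>xs\<close>, so a single partition of
    the class suffices to bound their number.\<close>
  obtain f where f: "f \<in> A \<rightarrow>\<^sub>E {..<length xs}"
    "\<forall>i<length xs. v ` {x \<in> A. f x = i} = xs ! i"
    using xs partition_labelling[OF _ A, of \<rho> v xs] \<rho> by auto
  have le: "card {i. i < length xs \<and> v x \<in> xs ! i} \<le> L" if x: "x \<in> A" for x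
  proof -
    have "{i. i < length xs \<and> v x \<in> xs ! i} \<subseteq> f ` {y \<in> A. v y = v x}"
    proof
      fix i assume "i \<in> {i. i < length xs \<and> v x \<in> xs ! i}"
      then have "v x \<in> v ` {x \<in> A. f x = i}" using f(2) by simp
      then show "i \<in> f ` {y \<in> A. v y = v x}" by force
    qed
    then have "card {i. i < length xs \<and> v x \<in> xs ! i} \<le> card (f ` {y \<in> A. v y = v x})"
      using A by (intro card_mono) auto
    also have "\<dots> \<le> card {y \<in> A. v y = v x}" using A by (intro card_image_le) simp
    finally show ?thesis using L[OF x] by simp
  qed
  have "card ?C \<le> card ?F"
  proof -
    have fin: "finite ?F" using A by (intro finite_PiE) auto
    then have "card ?C \<le> card ((\<lambda>f. (\<lambda>i. {x \<in> A. f x = i}) ` {..<length xs}) ` ?F)"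
      by (intro card_mono sub) simp
    also have "\<dots> \<le> card ?F" using fin by (rule card_image_le)
    finally show ?thesis .
  qed
  also have "\<dots> = (\<Prod>x\<in>A. card {i. i < length xs \<and> v x \<in> xs ! i})" using A by (rule card_PiE)
  also have "\<dots> \<le> (\<Prod>x\<in>A. L)" by (rule prod_mono) (use le in auto)
  finally show ?thesis by simp
qed (simp only: card.empty)

lemma card_partition_on_le:
  assumes \<rho>: "partition_on A \<rho>" and A: "finite A"
  shows "card \<rho> \<le> card A"
proof -
  have fin: "finite B" if "B \<in> \<rho>" for B
    using that partition_onD1[OF \<rho>] A by (metis Sup_upper finite_subset)
  have "card \<rho> = (\<Sum>B\<in>\<rho>. 1)" by simp
  also have "\<dots> \<le> (\<Sum>B\<in>\<rho>. card B)"
    using fin partition_onD3[OF \<rho>] by (intro sum_mono) (auto simp: Suc_le_eq card_gt_0_iff)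
  also have "\<dots> = card (\<Union>\<rho>)"
    using fin partition_onD2[OF \<rho>] by (intro card_Union_disjoint[symmetric]) (auto simp: pairwise_def disjoint_def disjnt_def)
  finally show ?thesis using partition_onD1[OF \<rho>] by simp
qed

text \<open>Three choices, one factor each: the set of traces, which inherits avoidance because
  \<open>v\<close> is monotone; the multiset of traces, of size at most \<open>n\<close> since a
  partition of \<open>n\<close> points has at most \<open>n\<close> blocks; and the partition with
  these traces.\<close>

lemma card_avoiding_partitions_le:
  assumes cA: "\<And>H. H \<in> avoiders d m s k \<Longrightarrow> card H \<le> V" and k: "k \<ge> 1"
  shows "card {\<rho>. partition_on {1..n} \<rho> \<and> \<not> occurs d m s \<rho> (\<lambda>E. E)} \<le>
    card (avoiders d m s k) * (2 ^ (n + V) * (n div k + 1) ^ n)" (is "card ?R \<le> _")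
proof -
  \<comment> \<open>Adding 1 ensures \<open>n < k * L\<close>, so \<open>k\<close> intervals of
    length \<open>L\<close> suffice.\<close>
  define L where "L = n div k + 1"
  define v where "v x = (x - 1) div L" for x
  define Cl where "Cl M = {\<rho>. partition_on {1..n} \<rho> \<and> image_mset (\<lambda>B. v ` B) (mset_set \<rho>) = M}" for M
  define MS where "MS H = {M. set_mset M \<subseteq> H \<and> size M \<le> n}" for H :: "nat set set"
  have vk: "v x < k" if "x \<in> {1..n}" for x
  proof -
    have "n < k * L" unfolding L_def using k dividend_less_times_div[of k n] by simp
    then have "x - 1 < k * L" using that by (auto intro: le_less_trans)
    then show ?thesis unfolding v_def by (simp add: L_def less_mult_imp_div_less)
  qed
  have cell: "card {y \<in> {1..n}. v y = v x} \<le> L" for x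
  proof -
    have "{y \<in> {1..n}. v y = v x} \<subseteq> Suc ` {L * v x..<L * v x + L}"
    proof
      fix y assume y: "y \<in> {y \<in> {1..n}. v y = v x}"
      have "L > 0" by (simp add: L_def)
      then have "L * v y \<le> y - 1" "y - 1 < L + L * v y"
        unfolding v_def by (simp, rule dividend_less_times_div)
      then have "y - 1 \<in> {L * v x..<L * v x + L}" using y by simp
      moreover have "y = Suc (y - 1)" using y by simp
      ultimately show "y \<in> Suc ` {L * v x..<L * v x + L}" by blast
    qed
    then have "card {y \<in> {1..n}. v y = v x} \<le> card (Suc ` {L * v x..<L * v x + L})"
      by (intro card_mono) auto
    then show ?thesis by (simp add: card_image)
  qed
  have finCl: "finite (Cl M)" for M
    by (rule finite_subset[OF _ finitely_many_partition_on[of "{1..n}"]]) (auto simp: Cl_def)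
  have sub: "?R \<subseteq> (\<Union>H\<in>avoiders d m s k. \<Union>M\<in>MS H. Cl M)"
  proof
    fix \<rho> assume "\<rho> \<in> ?R"
    then have \<rho>: "partition_on {1..n} \<rho>" "\<not> occurs d m s \<rho> (\<lambda>E. E)" by auto
    have fin: "finite \<rho>" using finite_elements[OF _ \<rho>(1)] by simp
    define M where "M = image_mset (\<lambda>B. v ` B) (mset_set \<rho>)"
    have M: "set_mset M = (\<lambda>B. v ` B) ` \<rho>" using fin by (simp add: M_def)
    have "\<not> occurs d m s (set_mset M) (\<lambda>E. E)"
    proof
      assume "occurs d m s (set_mset M) (\<lambda>E. E)"
      then have "occurs d m s \<rho> (\<lambda>E. E)"
        unfolding M
      proof (rule occurs_lift[where h = "inv_into \<rho> ((`) v)" and \<phi> = v])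
        show "inj_on (inv_into \<rho> ((`) v)) ((`) v ` \<rho>)" by (rule inj_on_inv_into) simp
        show "mono v" by (simp add: mono_def v_def div_le_mono)
        fix E assume E: "E \<in> (`) v ` \<rho>"
        show "inv_into \<rho> ((`) v) E \<in> \<rho>" using E by (rule inv_into_into)
        show "E \<subseteq> v ` inv_into \<rho> ((`) v) E" using f_inv_into_f[OF E] by simp
      qed
      then show False using \<rho>(2) by contradiction
    qed
    moreover have "set_mset M \<subseteq> Pow {..<k}"
      unfolding M
    proof (intro image_subsetI PowI)
      fix B x assume "B \<in> \<rho>" "x \<in> B"
      then have "x \<in> {1..n}" using partition_onD1[OF \<rho>(1)] by blast
      then show "v x \<in> {..<k}" using vk by simp
    qed
    ultimately have "set_mset M \<in> avoiders d m s k" by (simp add: avoiders_def)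
    moreover have "M \<in> MS (set_mset M)"
    proof -
      have "card \<rho> \<le> card {1..n}" using \<rho>(1) by (intro card_partition_on_le) auto
      then show ?thesis by (simp add: MS_def) (simp add: M_def)
    qed
    moreover have "\<rho> \<in> Cl M" using \<rho>(1) by (simp add: Cl_def M_def)
    ultimately show "\<rho> \<in> (\<Union>H\<in>avoiders d m s k. \<Union>M\<in>MS H. Cl M)" by blast
  qed
  have finH: "finite H" if "H \<in> avoiders d m s k" for H
    using that by (auto simp: avoiders_def intro: finite_subset)
  have MS: "finite (MS H)" "card (MS H) \<le> 2 ^ (n + V)" if H: "H \<in> avoiders d m s k" for H
  proof -
    show "finite (MS H)" using multisets_bounded_size[OF finH[OF H]] by (simp add: MS_def)
    have "card (MS H) \<le> 2 ^ (n + card H)" using multisets_bounded_size[OF finH[OF H]] by (simp add: MS_def)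
    also have "\<dots> \<le> 2 ^ (n + V)" using cA[OF H] by (intro power_increasing) auto
    finally show "card (MS H) \<le> 2 ^ (n + V)" .
  qed
  have Clcard: "card (Cl M) \<le> L ^ n" for M
    using card_partitions_trace_le[of "{1..n}" v L M] cell by (simp add: Cl_def)
  have "card ?R \<le> card (\<Union>H\<in>avoiders d m s k. \<Union>M\<in>MS H. Cl M)"
    by (rule card_mono[OF _ sub]) (use finite_avoiders MS finCl in auto)
  also have "\<dots> \<le> (\<Sum>H\<in>avoiders d m s k. card (\<Union>M\<in>MS H. Cl M))"
    by (rule card_UN_le[OF finite_avoiders])
  also have "\<dots> \<le> (\<Sum>H\<in>avoiders d m s k. 2 ^ (n + V) * L ^ n)"
  proof (rule sum_mono)
    fix H assume H: "H \<in> avoiders d m s k"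
    have "card (\<Union>M\<in>MS H. Cl M) \<le> (\<Sum>M\<in>MS H. card (Cl M))" by (rule card_UN_le[OF MS(1)[OF H]])
    also have "\<dots> \<le> (\<Sum>M\<in>MS H. L ^ n)" by (rule sum_mono) (rule Clcard)
    also have "\<dots> \<le> 2 ^ (n + V) * L ^ n" using MS(2)[OF H] by (simp add: mult_le_mono1)
    finally show "card (\<Union>M\<in>MS H. Cl M) \<le> 2 ^ (n + V) * L ^ n" .
  qed
  finally show ?thesis by (simp add: L_def)
qed

lemma avoiding_partitions_bound:
  assumes s: "inj_on (s 0) {..<m}" and d: "d \<ge> 1"
  shows "\<exists>c::real. \<forall>n\<ge>1. real (card {\<rho>. partition_on {1..n} \<rho> \<and> \<not> occurs d m s \<rho> (\<lambda>E. E)})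
    \<le> c ^ n * real n powr (real n * (1 - 1 / real d))"
proof -
  obtain C where C: "\<forall>k\<ge>1. \<forall>H\<in>avoiders d m s k. card H \<le> C * k ^ d"
    using card_avoider_le[where d = d and s = s and m = m] s d by blast
  obtain c where c: "c \<ge> (1::real)" "\<forall>e. real (card (avoiders d m s (2 ^ e))) \<le> c ^ ((2 ^ e) ^ d)"
    using card_avoiders_le[where d = d and s = s and m = m] s d by blast
  \<comment> \<open>The base collects \<open>c\<close> for the hypergraphs,
    \<open>2 ^ (1 + C)\<close> for the multisets and 4 for the choice of blocks.\<close>
  have "real (card {\<rho>. partition_on {1..n} \<rho> \<and> \<not> occurs d m s \<rho> (\<lambda>E. E)})
    \<le> (c * 2 ^ (1 + C) * 4) ^ n * real n powr (real n * (1 - 1 / real d))" (is "real ?R \<le> _") if n: "n \<ge> 1" for n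
  proof -
    \<comment> \<open>With \<open>k = 2 ^ e\<close> the inequality \<open>k ^ d \<le> n\<close>
      keeps the hypergraph count exponential in \<open>n\<close>, and \<open>n < (2 * k) ^ d\<close>
      keeps the intervals short.\<close>
    have "\<exists>e. n < (2 ^ Suc e) ^ d \<and> (2 ^ e) ^ d \<le> n"
    proof -
      define e where "e = (LEAST e. n < (2 ^ e) ^ d)"
      have "n < (2 ^ n) ^ d"
        using less_exp[of n] self_le_power[of "2 ^ n" d] d by (meson less_le_trans one_le_power one_le_numeral zero_less_one le_less_trans not_le)
      then have e: "n < (2 ^ e) ^ d" unfolding e_def by (rule LeastI)
      have "e \<noteq> 0" using e n by (intro notI) simp
      then obtain e' where e': "e = Suc e'" by (cases e) auto
      have "\<not> n < (2 ^ e') ^ d" using not_less_Least[of e' "\<lambda>e. n < (2 ^ e) ^ d"] e' by (simp add: e_def)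
      then show ?thesis using e e' by (intro exI[of _ e']) simp
    qed
    then obtain e where e: "n < (2 ^ Suc e) ^ d" "(2 ^ e) ^ d \<le> n" by blast
    define k :: nat where "k = 2 ^ e"
    have k: "k \<ge> 1" "n < (2 * k) ^ d" "k ^ d \<le> n" using e by (simp_all add: k_def)
    have "k \<le> k ^ d" using k(1) d by (intro self_le_power) auto
    then have kn: "k \<le> n" using k(3) by simp
    have V: "card H \<le> C * n" if "H \<in> avoiders d m s k" for H
      using C k(1) that mult_le_mono2[OF k(3), of C] by (meson le_trans)
    have "?R \<le> card (avoiders d m s k) * (2 ^ (n + C * n) * (n div k + 1) ^ n)"
      by (rule card_avoiding_partitions_le[OF V k(1)])
    then have "real ?R \<le> real (card (avoiders d m s k) * (2 ^ (n + C * n) * (n div k + 1) ^ n))"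
      by (rule of_nat_mono)
    also have "\<dots> = real (card (avoiders d m s k)) * (2 ^ (n + C * n) * real (n div k + 1) ^ n)" by simp
    also have "\<dots> \<le> c ^ n * (2 ^ (n + C * n) * (4 * real n powr (1 - 1 / real d)) ^ n)"
    proof (intro mult_mono power_mono order.refl)
      have "real (card (avoiders d m s k)) \<le> c ^ (k ^ d)" using c(2) by (simp add: k_def)
      also have "\<dots> \<le> c ^ n" using k(3) c(1) by (rule power_increasing)
      finally show "real (card (avoiders d m s k)) \<le> c ^ n" .
      have "real n \<le> real (2 * k) ^ d" using k(2) by (metis less_imp_le of_nat_le_iff of_nat_power)
      then have "real n powr (1 / real d) \<le> (real (2 * k) ^ d) powr (1 / real d)" by (intro powr_mono2) auto
      also have "\<dots> = real (2 * k)"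
        using d k(1) by (simp add: powr_realpow[symmetric] powr_powr del: of_nat_mult)
      finally have kp: "real n powr (1 / real d) \<le> 2 * real k" by simp
      have np: "real n powr (1 / real d) * real n powr (1 - 1 / real d) = real n"
        using n by (simp add: powr_add[symmetric])
      have "real (n div k) * real k \<le> real n"
        by (metis div_times_less_eq_dividend of_nat_le_iff of_nat_mult)
      then have "real (n div k + 1) \<le> real n / real k + 1" using k(1) by (simp add: pos_le_divide_eq)
      \<comment> \<open>One factor 2 absorbs the added 1, because \<open>k \<le> n\<close>; the next
        comes from n^(1/d) \<le> 2k.\<close>
      also have "\<dots> \<le> 2 * (real n / real k)" using kn k(1) by (simp add: field_simps)
      also have "\<dots> \<le> 4 * real n powr (1 - 1 / real d)"
      proof -
        have "real n \<le> 2 * real k * real n powr (1 - 1 / real d)"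
          using mult_right_mono[OF kp, of "real n powr (1 - 1 / real d)"] np by simp
        then show ?thesis using k(1) by (simp add: field_simps)
      qed
      finally show "real (n div k + 1) \<le> 4 * real n powr (1 - 1 / real d)" .
    qed (use c in auto)
    also have "\<dots> = (c * 2 ^ (1 + C) * 4) ^ n * (real n powr (1 - 1 / real d)) ^ n"
    proof -
      have "n + C * n = (1 + C) * n" by simp
      then have "(2::real) ^ (n + C * n) = (2 ^ (1 + C)) ^ n" by (simp only: power_mult)
      then show ?thesis by (simp only: power_mult_distrib mult_ac)
    qed
    also have "(real n powr (1 - 1 / real d)) ^ n = real n powr (real n * (1 - 1 / real d))"
      using n by (subst powr_power) auto
    finally show ?thesis .
  qed
  then show ?thesis by blast
qed

section \<open>Set partition containment\<close>

lemma image_restrict_partition: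
  "(`) f ` restrict_partition S \<pi> = (\<lambda>B. f ` (S \<inter> B)) ` \<pi> - {{}}"
  by (auto simp: restrict_partition_def)

lemma contains_partition_trans:
  assumes "contains_partition \<rho> \<pi>" "contains_partition \<pi> \<tau>"
  shows "contains_partition \<rho> \<tau>"
proof -
  from assms(1) obtain S f where f: "S \<subseteq> \<Union>\<rho>" "bij_betw f S (\<Union>\<pi>)" "strict_mono_on S f"
    "(\<lambda>B. f ` (S \<inter> B)) ` \<rho> - {{}} = \<pi>"
    by (auto simp: contains_partition_def image_restrict_partition)
  from assms(2) obtain R g where g: "R \<subseteq> \<Union>\<pi>" "bij_betw g R (\<Union>\<tau>)" "strict_mono_on R g"
    "(\<lambda>B. g ` (R \<inter> B)) ` \<pi> - {{}} = \<tau>"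
    by (auto simp: contains_partition_def image_restrict_partition)
  define Q where "Q = {x \<in> S. f x \<in> R}"
  have fQ: "f ` Q = R"
  proof
    show "f ` Q \<subseteq> R" by (auto simp: Q_def)
    show "R \<subseteq> f ` Q"
    proof
      fix y assume y: "y \<in> R"
      then have "y \<in> f ` S" using g(1) f(2) by (auto simp: bij_betw_def)
      then show "y \<in> f ` Q" using y by (auto simp: Q_def)
    qed
  qed
  have "inj_on f Q" using f(2) by (auto simp: bij_betw_def Q_def intro: inj_on_subset)
  then have bij: "bij_betw (g \<circ> f) Q (\<Union>\<tau>)"
    using g(2) fQ by (intro bij_betw_trans[where B = R]) (simp add: bij_betw_def)
  have mono: "strict_mono_on Q (g \<circ> f)"
  proof (rule strict_mono_onI)
    fix x y assume xy: "x \<in> Q" "y \<in> Q" "x < y"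
    then have "f x < f y" using f(3) by (auto simp: Q_def strict_mono_on_def)
    then show "(g \<circ> f) x < (g \<circ> f) y" using g(3) xy by (auto simp: Q_def strict_mono_on_def)
  qed
  have img: "(g \<circ> f) ` (Q \<inter> B) = g ` (R \<inter> f ` (S \<inter> B))" for B
    by (auto simp: Q_def)
  have "(\<lambda>B. (g \<circ> f) ` (Q \<inter> B)) ` \<rho> - {{}} = (\<lambda>B. g ` (R \<inter> B)) ` ((\<lambda>B. f ` (S \<inter> B)) ` \<rho>) - {{}}"
    by (simp only: img image_image)
  \<comment> \<open>Blocks emptied by the first restriction stay empty under the second, so they may
    be discarded at either stage.\<close>
  also have "\<dots> = (\<lambda>B. g ` (R \<inter> B)) ` ((\<lambda>B. f ` (S \<inter> B)) ` \<rho> - {{}}) - {{}}"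
    by auto
  also have "\<dots> = \<tau>" by (simp only: f(4) g(4))
  finally have "(`) (g \<circ> f) ` restrict_partition Q \<rho> = \<tau>" by (simp only: image_restrict_partition)
  moreover have "Q \<subseteq> \<Union>\<rho>" using f(1) by (auto simp: Q_def)
  ultimately show ?thesis unfolding contains_partition_def using bij mono by blast
qed

text \<open>Row 0 carries the identity because the block with index \<open>i\<close> contains
  \<open>i\<close> itself. \<open>Suc\<close> translates the indices of \<open>occurs\<close>, which
  start at 0, to permutations of \<open>{1..m}\<close>.\<close>

definition perm_rank :: "(nat \<Rightarrow> nat \<Rightarrow> nat) \<Rightarrow> nat \<Rightarrow> nat \<Rightarrow> nat" where
  "perm_rank \<sigma> j i = (if j = 0 then Suc i else \<sigma> j (Suc i))"

lemma inj_perm_rank_0: "inj_on (perm_rank \<sigma> 0) A"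
  by (simp add: perm_rank_def inj_on_def)

text \<open>The points \<open>X p\<close> of the occurrence and the entries \<open>g p\<close> of
  the permutation partition are both ordered lexicographically by row and rank, so matching them is
  an order isomorphism. Disjointness of the blocks makes \<open>e i\<close> meet the selected points
  exactly in those of index \<open>i\<close>, and all other blocks miss them.\<close>

lemma occurs_imp_contains_perm_partition:
  assumes \<sigma>: "\<forall>j\<in>{1..d}. \<sigma> j permutes {1..m}" and \<rho>: "disjoint \<rho>"
    and occ: "occurs d m (perm_rank \<sigma>) \<rho> (\<lambda>E. E)"
  shows "contains_partition \<rho> (perm_partition m d \<sigma>)"
  using occ
proof (rule occursE)
  fix e x
  assume e: "inj_on e {..<m}" "\<And>i. i < m \<Longrightarrow> e i \<in> \<rho>"
    and x: "\<And>i j. i < m \<Longrightarrow> j \<le> d \<Longrightarrow> x i j \<in> e i"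
      "\<And>i i' j j'. i < m \<Longrightarrow> i' < m \<Longrightarrow> j < j' \<Longrightarrow> j' \<le> d \<Longrightarrow> x i j < x i' j'"
      "\<And>i i' j. i < m \<Longrightarrow> i' < m \<Longrightarrow> j \<le> d \<Longrightarrow> perm_rank \<sigma> j i < perm_rank \<sigma> j i' \<Longrightarrow> x i j < x i' j"
  define D where "D = {..<m} \<times> {..d}"
  define X where "X p = x (fst p) (snd p)" for p
  define g where "g p = snd p * m + perm_rank \<sigma> (snd p) (fst p)" for p
  have rank: "1 \<le> perm_rank \<sigma> j i" "perm_rank \<sigma> j i \<le> m" if "i < m" "j \<le> d" for i j
  proof -
    have "perm_rank \<sigma> j i \<in> {1..m}"
    proof (cases "j = 0")
      case False
      then have "\<sigma> j (Suc i) \<in> {1..m}" using \<sigma> that permutes_in_image[of "\<sigma> j" "{1..m}" "Suc i"] by simp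
      then show ?thesis using False by (simp add: perm_rank_def)
    qed (use that in \<open>simp add: perm_rank_def\<close>)
    then show "1 \<le> perm_rank \<sigma> j i" "perm_rank \<sigma> j i \<le> m" by auto
  qed
  have rank_inj: "i = i'" if "j \<le> d" "perm_rank \<sigma> j i = perm_rank \<sigma> j i'" for i i' j
  proof (cases "j = 0")
    case False
    then have "inj (\<sigma> j)" using \<sigma> that(1) permutes_inj[of "\<sigma> j" "{1..m}"] by simp
    then show ?thesis using that(2) False by (simp add: perm_rank_def inj_eq)
  qed (use that in \<open>simp add: perm_rank_def\<close>)
  have gX: "g p < g q \<and> X p < X q"
    if "p \<in> D" "q \<in> D" "snd p < snd q \<or> snd p = snd q \<and> perm_rank \<sigma> (snd p) (fst p) < perm_rank \<sigma> (snd p) (fst q)"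
    for p q
    using that(3)
  proof
    assume lt: "snd p < snd q"
    have pq: "fst p < m" "snd p \<le> d" "fst q < m" "snd q \<le> d" using that(1,2) by (auto simp: D_def)
    have "g p \<le> Suc (snd p) * m" using rank[OF pq(1,2)] by (simp add: g_def)
    also have "\<dots> \<le> snd q * m" using lt by (intro mult_le_mono1) simp
    also have "\<dots> < g q" using rank[OF pq(3,4)] by (simp add: g_def)
    finally show ?thesis using x(2)[OF pq(1,3) lt pq(4)] by (simp add: X_def)
  next
    assume lt: "snd p = snd q \<and> perm_rank \<sigma> (snd p) (fst p) < perm_rank \<sigma> (snd p) (fst q)"
    have pq: "fst p < m" "snd p \<le> d" "fst q < m" using that(1,2) by (auto simp: D_def)
    have "X p < X q" using x(3)[OF pq(1,3,2) conjunct2[OF lt]] lt by (simp add: X_def)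
    moreover have "g p < g q" using conjunct1[OF lt] conjunct2[OF lt] by (simp add: g_def)
    ultimately show ?thesis by simp
  qed
  have total: "g p < g q \<and> X p < X q \<or> g q < g p \<and> X q < X p" if "p \<in> D" "q \<in> D" "p \<noteq> q" for p q
  proof -
    have "snd p \<noteq> snd q \<or> perm_rank \<sigma> (snd p) (fst p) \<noteq> perm_rank \<sigma> (snd p) (fst q)"
      using rank_inj[of "snd p" "fst p" "fst q"] that by (auto simp: D_def prod_eq_iff)
    then show ?thesis using gX[OF that(1,2)] gX[OF that(2,1)] by (metis linorder_neqE_nat)
  qed
  have injX: "inj_on X D" and injg: "inj_on g D"
    using total by (fastforce simp: inj_on_def)+
  define f where "f = g \<circ> inv_into D X"
  have fX: "f (X p) = g p" if "p \<in> D" for p using that injX by (simp add: f_def)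
  have fimg: "f ` X ` E = g ` E" if "E \<subseteq> D" for E
  proof -
    have "f ` X ` E = (\<lambda>p. f (X p)) ` E" by (rule image_image)
    also have "\<dots> = g ` E" using fX that by (intro image_cong) auto
    finally show ?thesis .
  qed
  have mono: "strict_mono_on (X ` D) f"
  proof (rule strict_mono_onI)
    fix y z assume "y \<in> X ` D" "z \<in> X ` D" "y < z"
    then obtain p q where pq: "p \<in> D" "q \<in> D" "y = X p" "z = X q" "X p < X q" by auto
    then have "g p < g q" using total[of p q] by (cases "p = q") auto
    then show "f y < f z" using pq fX by simp
  qed
  have row: "insert (Suc i) {j * m + \<sigma> j (Suc i) | j. j \<in> {1..d}} = g ` ({i} \<times> {..d})" for i
  proof -
    have "{i} \<times> {..d} = Pair i ` insert 0 {1..d}" by auto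
    then have "g ` ({i} \<times> {..d}) = (\<lambda>j. g (i, j)) ` insert 0 {1..d}" by (simp only: image_image)
    also have "\<dots> = insert (Suc i) ((\<lambda>j. j * m + \<sigma> j (Suc i)) ` {1..d})"
      by (auto simp: g_def perm_rank_def intro!: image_eqI)
    finally show ?thesis by (simp only: setcompr_eq_image Collect_mem_eq)
  qed
  have P: "perm_partition m d \<sigma> = (\<lambda>i. g ` ({i} \<times> {..d})) ` {..<m}"
  proof -
    have "{1..m} = Suc ` {..<m}" by (simp add: image_Suc_lessThan)
    then have "perm_partition m d \<sigma> = (\<lambda>i. insert (Suc i) {j * m + \<sigma> j (Suc i) | j. j \<in> {1..d}}) ` {..<m}"
      unfolding perm_partition_def by (simp only: image_image)
    then show ?thesis by (simp only: row)
  qed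
  have UP: "\<Union>(perm_partition m d \<sigma>) = g ` D" unfolding P D_def by auto
  have "inj_on f (X ` D)" using mono by (rule strict_mono_on_imp_inj_on)
  then have bij: "bij_betw f (X ` D) (\<Union>(perm_partition m d \<sigma>))"
    unfolding UP using fimg[of D] by (simp add: bij_betw_def)
  have same: "i = i'" if "i < m" "i' < m" "y \<in> e i" "y \<in> e i'" for i i' y
  proof -
    have "e i = e i'" using \<rho> e(2)[OF that(1)] e(2)[OF that(2)] that(3,4) by (auto dest: disjointD)
    then show ?thesis using e(1) that(1,2) by (auto simp: inj_on_def)
  qed
  have cut: "X ` D \<inter> e i = X ` ({i} \<times> {..d})" if "i < m" for i
  proof (intro set_eqI iffI)
    fix y assume y: "y \<in> X ` D \<inter> e i"
    then obtain i' j where ij: "i' < m" "j \<le> d" "y = x i' j" by (auto simp: D_def X_def)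
    then have "i' = i" using same[of i' i y] x(1)[of i' j] y that by simp
    then have "y = X (i, j)" using ij by (simp add: X_def)
    then show "y \<in> X ` ({i} \<times> {..d})" by (rule image_eqI) (use ij in simp)
  next
    fix y assume "y \<in> X ` ({i} \<times> {..d})"
    then obtain j where j: "j \<le> d" "y = X (i, j)" by auto
    have "(i, j) \<in> D" using that j(1) by (simp add: D_def)
    then have "y \<in> X ` D" unfolding j(2) by (rule imageI)
    moreover have "y \<in> e i" using x(1)[OF that j(1)] j(2) by (simp add: X_def)
    ultimately show "y \<in> X ` D \<inter> e i" ..
  qed
  have other: "X ` D \<inter> B = {}" if "B \<in> \<rho>" "B \<notin> e ` {..<m}" for B
  proof (rule ccontr)
    assume "X ` D \<inter> B \<noteq> {}"
    then obtain i j where ij: "i < m" "j \<le> d" "x i j \<in> B" by (auto simp: D_def X_def)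
    then have "B = e i" using \<rho> that(1) e(2)[OF ij(1)] x(1)[OF ij(1,2)] by (auto dest: disjointD)
    then show False using that(2) ij(1) by simp
  qed
  have fcut: "f ` (X ` D \<inter> e i) = g ` ({i} \<times> {..d})" if "i < m" for i
    unfolding cut[OF that] using that by (intro fimg) (auto simp: D_def)
  have "(\<lambda>B. f ` (X ` D \<inter> B)) ` \<rho> - {{}} = (\<lambda>B. f ` (X ` D \<inter> B)) ` e ` {..<m}"
  proof (intro set_eqI iffI)
    fix Z assume "Z \<in> (\<lambda>B. f ` (X ` D \<inter> B)) ` \<rho> - {{}}"
    then obtain B where B: "B \<in> \<rho>" "Z = f ` (X ` D \<inter> B)" "Z \<noteq> {}" by auto
    then have "B \<in> e ` {..<m}" using other[of B] by auto
    then show "Z \<in> (\<lambda>B. f ` (X ` D \<inter> B)) ` e ` {..<m}" using B(2) by (rule rev_image_eqI)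
  next
    fix Z assume "Z \<in> (\<lambda>B. f ` (X ` D \<inter> B)) ` e ` {..<m}"
    then obtain i where i: "i < m" "Z = f ` (X ` D \<inter> e i)" by auto
    then have "Z \<noteq> {}" using fcut[OF i(1)] by auto
    moreover have "Z \<in> (\<lambda>B. f ` (X ` D \<inter> B)) ` \<rho>" using i(2) e(2)[OF i(1)] by (rule image_eqI)
    ultimately show "Z \<in> (\<lambda>B. f ` (X ` D \<inter> B)) ` \<rho> - {{}}" by simp
  qed
  also have "\<dots> = (\<lambda>i. f ` (X ` D \<inter> e i)) ` {..<m}" by (rule image_image)
  also have "\<dots> = perm_partition m d \<sigma>" unfolding P using fcut by (intro image_cong) auto
  finally have "(`) f ` restrict_partition (X ` D) \<rho> = perm_partition m d \<sigma>"
    by (simp only: image_restrict_partition)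
  moreover have "X ` D \<subseteq> \<Union>\<rho>"
  proof
    fix y assume "y \<in> X ` D"
    then obtain i j where ij: "i < m" "j \<le> d" "y = x i j" by (auto simp: D_def X_def)
    then show "y \<in> \<Union>\<rho>" using x(1)[OF ij(1,2)] e(2)[OF ij(1)] by auto
  qed
  ultimately show ?thesis unfolding contains_partition_def using bij mono by blast
qed

text \<open>With a single row, an occurrence only needs \<open>m\<close> distinct blocks with
  representatives in a prescribed order. The minima of disjoint blocks are distinct numbers, so they
  can be arranged in that order.\<close>

lemma few_blocks_if_no_occurs:
  assumes \<rho>: "partition_on A \<rho>" and A: "finite (A :: nat set)" and s: "inj_on (s 0) {..<m}"
    and av: "\<not> occurs 0 m s \<rho> (\<lambda>E. E)"
  shows "card \<rho> \<le> m"
proof (rule ccontr)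
  assume "\<not> card \<rho> \<le> m"
  have fin: "finite B" if "B \<in> \<rho>" for B
    using that partition_onD1[OF \<rho>] A by (metis Sup_upper finite_subset)
  have Min: "Min B \<in> B" if "B \<in> \<rho>" for B using fin[OF that] that partition_onD3[OF \<rho>] by (intro Min_in) auto
  have inj: "inj_on Min \<rho>"
  proof (rule inj_onI)
    fix B B' assume B: "B \<in> \<rho>" "B' \<in> \<rho>" "Min B = Min B'"
    then have "Min B \<in> B \<inter> B'" using Min[OF B(1)] Min[OF B(2)] by simp
    then show "B = B'" using disjointD[OF partition_onD2[OF \<rho>] B(1,2)] by blast
  qed
  have "finite (Min ` \<rho>)" "m \<le> card (Min ` \<rho>)"
    using finite_elements[OF A \<rho>] card_image[OF inj] \<open>\<not> card \<rho> \<le> m\<close> by auto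
  from ex_order_embedding[OF this, of "s 0"]
  obtain h where h: "h ` {..<m} \<subseteq> Min ` \<rho> \<and> (\<forall>a<m. \<forall>b<m. s 0 a < s 0 b \<longrightarrow> h a < h b)" ..
  define e where "e a = inv_into \<rho> Min (h a)" for a
  have e: "e a \<in> \<rho>" "Min (e a) = h a" if "a < m" for a
  proof -
    have "h a \<in> Min ` \<rho>" by (rule subsetD[OF conjunct1[OF h] imageI]) (use that in simp)
    then show "e a \<in> \<rho>" "Min (e a) = h a" unfolding e_def by (rule inv_into_into, rule f_inv_into_f)
  qed
  have "occurs 0 m s \<rho> (\<lambda>E. E)"
  proof (rule occursI[where e = e and x = "\<lambda>i _. h i"])
    show "inj_on e {..<m}"
    proof (rule inj_onI)
      fix a b assume ab: "a \<in> {..<m}" "b \<in> {..<m}" "e a = e b"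
      then have "h a = h b" using e(2)[of a] e(2)[of b] by simp
      then have "\<not> s 0 a < s 0 b" "\<not> s 0 b < s 0 a" 
        using conjunct2[OF h, rule_format, of a b] conjunct2[OF h, rule_format, of b a] ab by auto
      then show "a = b" using s ab by (auto simp: inj_on_def)
    qed
    show "h i \<in> e i" if "i < m" for i using Min[OF e(1)[OF that]] e(2)[OF that] by simp
    show "h i < h i'" if "i < m" "i' < m" "j \<le> 0" "s j i < s j i'" for i i' j
      using conjunct2[OF h, rule_format, of i i'] that by simp
  qed (use e(1) in simp_all)
  then show False using av by contradiction
qed

lemma card_partitions_few_blocks_le:
  assumes A: "finite A"
  shows "card {\<rho>. partition_on A \<rho> \<and> card \<rho> \<le> m} \<le> m ^ card A"
proof -
  let ?F = "A \<rightarrow>\<^sub>E {..<m}"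
  have "{\<rho>. partition_on A \<rho> \<and> card \<rho> \<le> m} \<subseteq> (\<lambda>f. (\<lambda>i. {x \<in> A. f x = i}) ` f ` A) ` ?F"
  proof
    fix \<rho> assume "\<rho> \<in> {\<rho>. partition_on A \<rho> \<and> card \<rho> \<le> m}"
    then have \<rho>: "partition_on A \<rho>" "card \<rho> \<le> m" by auto
    \<comment> \<open>With the identity in place of \<open>v\<close>, the traces are the blocks
      themselves.\<close>
    obtain xs where xs: "mset xs = image_mset (\<lambda>B. id ` B) (mset_set \<rho>)" using ex_mset by blast
    obtain f where f: "f \<in> A \<rightarrow>\<^sub>E {..<length xs}" "\<rho> = (\<lambda>i. {x \<in> A. f x = i}) ` {..<length xs}"
      using partition_labelling[OF \<rho>(1) A xs[symmetric]] by auto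
    have "length xs = card \<rho>" using arg_cong[OF xs, of size] by simp
    then have F: "f \<in> ?F" using f(1) \<rho>(2) by (fastforce simp: PiE_iff)
    have "i \<in> f ` A" if "i < length xs" for i
    proof -
      have "{x \<in> A. f x = i} \<noteq> {}" using f(2) that partition_onD3[OF \<rho>(1)] by auto
      then show ?thesis by auto
    qed
    then have "f ` A = {..<length xs}" using f(1) by auto
    then have "\<rho> = (\<lambda>i. {x \<in> A. f x = i}) ` f ` A" using f(2) by simp
    then show "\<rho> \<in> (\<lambda>f. (\<lambda>i. {x \<in> A. f x = i}) ` f ` A) ` ?F" using F by (rule image_eqI)
  qed
  then have "card {\<rho>. partition_on A \<rho> \<and> card \<rho> \<le> m} \<le> card ((\<lambda>f. (\<lambda>i. {x \<in> A. f x = i}) ` f ` A) ` ?F)"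
    using A by (intro card_mono finite_imageI finite_PiE) auto
  also have "\<dots> \<le> card ?F" using A by (intro card_image_le finite_PiE) auto
  also have "\<dots> = m ^ card A" using A by (simp add: card_PiE)
  finally show ?thesis .
qed

theorem theorem3p2:
  fixes \<pi> :: "nat set set" and N :: nat
  assumes "partition_on {1..N} \<pi>"
  shows "(permutability \<pi> \<ge> 1 \<longrightarrow>
           (\<exists>c :: real. \<forall>n :: nat. n \<ge> 1 \<longrightarrow>
              real (avoid_count n \<pi>)
                \<le> c ^ n * real n powr (real n * (1 - 1 / real (permutability \<pi>)))))
       \<and> (permutability \<pi> = 0 \<longrightarrow>
           (\<exists>c :: real. \<forall>n :: nat. real (avoid_count n \<pi>) \<le> c ^ n))"
proof -
  define d where "d = permutability \<pi>"
  have "\<exists>m \<sigma>. (\<forall>j\<in>{1..d}. \<sigma> j permutes {1..m}) \<and> contains_partition (perm_partition m d \<sigma>) \<pi>"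
    unfolding d_def permutability_def by (rule LeastI_ex) (rule permutability_witness[OF assms])
  then obtain m \<sigma> where \<sigma>: "\<forall>j\<in>{1..d}. \<sigma> j permutes {1..m}"
    and con: "contains_partition (perm_partition m d \<sigma>) \<pi>" by blast
  define R where "R n = {\<rho>. partition_on {1..n} \<rho> \<and> \<not> occurs d m (perm_rank \<sigma>) \<rho> (\<lambda>E. E)}" for n
  \<comment> \<open>Containment is transitive, so an occurrence of the permutation partition in
    \<open>\<rho>\<close> would put \<open>\<pi>\<close> into \<open>\<rho>\<close>.\<close>
  have av: "avoid_count n \<pi> \<le> card (R n)" for n
    unfolding avoid_count_def
  proof (rule card_mono)
    show "finite (R n)"
      by (rule finite_subset[OF _ finitely_many_partition_on[of "{1..n}"]]) (auto simp: R_def)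
    show "{\<rho>. partition_on {1..n} \<rho> \<and> \<not> contains_partition \<rho> \<pi>} \<subseteq> R n"
      using occurs_imp_contains_perm_partition[OF \<sigma>] contains_partition_trans[OF _ con] partition_onD2
      unfolding R_def by blast
  qed
  show ?thesis
    unfolding d_def[symmetric]
  proof (intro conjI impI)
    assume "d \<ge> 1"
    then obtain c :: real where c: "\<forall>n\<ge>1. real (card (R n)) \<le> c ^ n * real n powr (real n * (1 - 1 / real d))"
      using avoiding_partitions_bound[where d = d and s = "perm_rank \<sigma>" and m = m] inj_perm_rank_0
      unfolding R_def by blast
    have "real (avoid_count n \<pi>) \<le> c ^ n * real n powr (real n * (1 - 1 / real d))" if "n \<ge> 1" for n
    proof -
      have "real (avoid_count n \<pi>) \<le> real (card (R n))" using av by (rule of_nat_mono)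
      also have "\<dots> \<le> c ^ n * real n powr (real n * (1 - 1 / real d))" using c that by blast
      finally show ?thesis .
    qed
    then show "\<exists>c::real. \<forall>n\<ge>1. real (avoid_count n \<pi>) \<le> c ^ n * real n powr (real n * (1 - 1 / real d))"
      by blast
  next
    assume d0: "d = 0"
    have "real (avoid_count n \<pi>) \<le> real m ^ n" for n
    proof -
      have "R n \<subseteq> {\<rho>. partition_on {1..n} \<rho> \<and> card \<rho> \<le> m}"
        using few_blocks_if_no_occurs[of "{1..n}" _ "perm_rank \<sigma>" m] inj_perm_rank_0
        unfolding R_def d0 by auto
      then have "card (R n) \<le> card {\<rho>. partition_on {1..n} \<rho> \<and> card \<rho> \<le> m}"
        by (rule card_mono[rotated])
          (auto intro: finite_subset[OF _ finitely_many_partition_on[of "{1..n}"]])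
      also have "\<dots> \<le> m ^ n" using card_partitions_few_blocks_le[of "{1..n}" m] by simp
      finally have "avoid_count n \<pi> \<le> m ^ n" using av le_trans by blast
      then show ?thesis by (metis of_nat_le_iff of_nat_power)
    qed
    then show "\<exists>c::real. \<forall>n. real (avoid_count n \<pi>) \<le> c ^ n" by blast
  qed
qed

end
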